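(* Let $A$ be a C*-algebra and $B\in[A]^\perp$ an annihilator. Then $B$ is commutative (as a C*-algebra) if and only if $[B]=\{C\in[A]^\perp: C\subseteq B\}$, ordered by inclusion, is a Boolean algebra.
   Context: For $a,b\in A$ write $a\perp b$ if $ab=0=ab^*$, and for $S\subseteq A$ put $S^\perp=\{b\in A:s\perp b\text{ for all }s\in S\}$. An annihilator of $A$ is a set of the form $S^\perp$, $S\subseteq A$; $[A]^\perp$ is the set of annihilators, a complete lattice under inclusion with infima given by intersection and $\bigvee\mathcal B=(\bigcup\mathcal B)^{\perp\perp}$. A Boolean algebra is a distributive complemented lattice. *)

theory Defs
  imports "HOL-Analysis.Analysis" "HOL-Algebra.Lattice"
begin

text \<open>
  Complex C*-algebras, not assumed to be unital (nor nonzero). \<open>scaleC_of_real\<close> ties the complex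
  scalar multiplication to the real one of the superclass; together with \<open>scaleR_one\<close> it yields
  \<open>scaleC 1 x = x\<close>, which is therefore not listed.
\<close>

class cstar_algebra = real_normed_algebra + banach +
  fixes scaleC :: "complex \<Rightarrow> 'a \<Rightarrow> 'a"
    and star :: "'a \<Rightarrow> 'a"
  assumes scaleC_add_right: "scaleC c (x + y) = scaleC c x + scaleC c y"
    and scaleC_add_left: "scaleC (c + d) x = scaleC c x + scaleC d x"
    and scaleC_scaleC: "scaleC c (scaleC d x) = scaleC (c * d) x"
    and scaleC_of_real: "scaleC (complex_of_real r) x = scaleR r x"
    and scaleC_mult_left: "scaleC c x * y = scaleC c (x * y)"
    and scaleC_mult_right: "x * scaleC c y = scaleC c (x * y)"
    and norm_scaleC: "norm (scaleC c x) = cmod c * norm x"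
    and star_add: "star (x + y) = star x + star y"
    and star_scaleC: "star (scaleC c x) = scaleC (cnj c) (star x)"
    and star_mult: "star (x * y) = star y * star x"
    and star_star: "star (star x) = x"
    and cstar_identity: "norm (star x * x) = (norm x)\<^sup>2"

text \<open>
  The relation \<open>perp\<close> is not symmetric on arbitrary elements, so the order of its arguments in
  \<open>annihilator\<close> matters.
\<close>

definition perp :: "'a::cstar_algebra \<Rightarrow> 'a \<Rightarrow> bool" where
  "perp a b \<longleftrightarrow> a * b = 0 \<and> a * star b = 0"

definition annihilator :: "'a::cstar_algebra set \<Rightarrow> 'a set" where
  "annihilator S = {b. \<forall>s\<in>S. perp s b}"

definition annihilators :: "'a::cstar_algebra set set" where
  "annihilators = range annihilator"

definition annihilators_below :: "'a::cstar_algebra set \<Rightarrow> 'a set gorder" where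
  "annihilators_below B =
    \<lparr>carrier = {C \<in> annihilators. C \<subseteq> B}, eq = (=), le = (\<subseteq>)\<rparr>"

text \<open>
  A Boolean algebra as a distributive complemented lattice; the one-element lattice is allowed.
  The other distributive law follows from the one assumed.
\<close>

locale boolean_lattice = bounded_lattice +
  assumes meet_join_distrib:
    "\<lbrakk>x \<in> carrier L; y \<in> carrier L; z \<in> carrier L\<rbrakk>
      \<Longrightarrow> x \<sqinter> (y \<squnion> z) = (x \<sqinter> y) \<squnion> (x \<sqinter> z)"
    and complement_exists:
    "x \<in> carrier L \<Longrightarrow> \<exists>y\<in>carrier L. x \<sqinter> y = \<bottom> \<and> x \<squnion> y = \<top>"

end

theory Submission
  imports Defs
begin

text \<open>
  Let \<open>B\<close> be an annihilator. Annihilators are closed, self-adjoint and hereditary (\<open>B A B \<subseteq> B\<close>), and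
  below \<open>B\<close> they form a lattice with intersections as meets and biannihilators of unions as joins.

  If \<open>B\<close> is commutative, then the annihilators below \<open>B\<close> are ideals of \<open>B\<close>. Let an annihilator \<open>U\<close>
  meet \<open>S\<^sup>\<bottom>\<close> trivially, \<open>S\<close> self-adjoint. If \<open>t\<close> kills the products \<open>u s\<close> for \<open>u \<in> U\<close>, \<open>s \<in> S\<close>, then
  \<open>u\<^sup>*t\<^sup>*t u\<close> is orthogonal to \<open>S\<close> but lies in \<open>U\<close>, so it vanishes, and \<open>t u = 0\<close>. Distributivity and
  the existence of complements are both instances (\<open>mult_eq_0_if_mult_products_eq_0\<close>).

  For the converse, an element \<open>x \<noteq> 0\<close> of \<open>B\<close> with \<open>x\<^sup>2 = 0\<close> behaves like a matrix unit \<open>e\<^sub>2\<^sub>1\<close>: the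
  supports of \<open>x\<^sup>*x\<close> and \<open>x x\<^sup>*\<close> are two coordinate axes, and the graph of \<open>x\<close> is a diagonal lying in their
  join and meeting both trivially, against distributivity (\<open>square_zero_of_boolean_lattice\<close>). So the
  theorem reduces to the fact that a C*-algebra without nonzero elements of square zero is
  commutative (\<open>commute_reduced\<close>), for which a unit may be adjoined.

  The latter is proved with no functional calculus beyond the binomial series of \<open>\<surd>(1 - x)\<close>, which
  converges in norm on the closed unit ball. It provides \<open>\<bar>b\<bar>\<close> for a self-adjoint contraction \<open>b\<close>.
  The parts \<open>b\<^sub>\<plusminus> = (\<bar>b\<bar> \<plusminus> b) / 2\<close> are orthogonal, hence \<open>b\<^sub>+ y b\<^sub>-\<close> and \<open>b\<^sub>- y b\<^sub>+\<close> have square zero, and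
  if only \<open>0\<close> has, then \<open>b y \<bar>b\<bar> = \<bar>b\<bar> y b\<close> (\<open>mult_cabs_swap\<close>). Apply this to \<open>b\<^sub>t = f (e\<^sup>i\<^sup>t u)\<close>, where \<open>u\<close>
  is a unitary and \<open>f\<close> is a trigonometric polynomial with frequencies \<open>\<plusminus>1, \<plusminus>2\<close>, and average over \<open>t\<close>.
  Only the Fourier coefficients of \<open>\<bar>f\<bar>\<close> at these frequencies survive, and with the isometry
  \<open>W y = u y u\<^sup>*\<close> one gets \<open>\<tau>\<^sub>1 (W - W\<^sup>-\<^sup>1) y + \<tau>\<^sub>2 (W\<^sup>2 - W\<^sup>-\<^sup>2) y = 0\<close> for real constants with \<open>\<tau>\<^sub>1 > 0\<close>
  (\<open>swap_identity\<close>). For \<open>u\<close> near \<open>1\<close> this forces \<open>W y = y\<close> (\<open>swap_imp_commute_near_one\<close>). Finally every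
  small self-adjoint element is the imaginary part of a unitary near \<open>1\<close>.
\<close>

section \<open>Elementary facts about C*-algebras\<close>

lemma star_0 [simp]: "star (0 :: 'a::cstar_algebra) = 0"
  using star_add[of 0 "0 :: 'a"] by simp

lemma star_eq_0_iff [simp]: "star x = 0 \<longleftrightarrow> x = 0"
  by (metis star_0 star_star)

lemma star_minus [simp]: "star (- x) = - star x"
  using star_add[of x "- x"] by (simp add: minus_unique)

lemma star_diff: "star (x - y) = star x - star y"
  using star_add[of x "- y"] by simp

lemma star_scaleR [simp]: "star (r *\<^sub>R x) = r *\<^sub>R star x"
  using star_scaleC[of "complex_of_real r" x] by (simp add: scaleC_of_real)

lemma scaleC_one [simp]: "scaleC 1 x = x"
  using scaleC_of_real[of 1 x] by simp

lemma scaleC_zero_left [simp]: "scaleC 0 x = 0"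
  using scaleC_of_real[of 0 x] by simp

lemma scaleC_zero_right [simp]: "scaleC c (0 :: 'a::cstar_algebra) = 0"
  using scaleC_add_right[of c 0 "0 :: 'a"] by simp

lemma scaleC_minus_left: "scaleC (- c) x = - scaleC c x"
  using scaleC_add_left[of c "- c" x] by (simp add: minus_unique)

lemma scaleC_minus_right: "scaleC c (- x) = - scaleC c x"
  using scaleC_add_right[of c x "- x"] by (simp add: minus_unique)

lemma scaleC_diff_right: "scaleC c (x - y) = scaleC c x - scaleC c y"
  using scaleC_add_right[of c x "- y"] by (simp add: scaleC_minus_right)

lemma scaleC_scaleR: "scaleC c (r *\<^sub>R x) = r *\<^sub>R scaleC c x"
  by (simp add: scaleC_of_real[symmetric] scaleC_scaleC mult.commute)

lemma scaleC_scaleR_left: "scaleC (r *\<^sub>R c) x = r *\<^sub>R scaleC c x"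
  by (simp add: scaleR_conv_of_real scaleC_scaleC[symmetric] scaleC_of_real)

lemma star_mult_self_eq_0_iff [simp]: "star x * x = 0 \<longleftrightarrow> x = 0"
  using cstar_identity[of x] by auto

lemma mult_star_self_eq_0_iff [simp]: "x * star x = 0 \<longleftrightarrow> x = 0"
  using star_mult_self_eq_0_iff[of "star x"] by (simp add: star_star)

text \<open>The C*-identity and submultiplicativity give \<open>\<parallel>x\<parallel>\<^sup>2 \<le> \<parallel>star x\<parallel> \<parallel>x\<parallel>\<close>, hence
  \<open>\<parallel>x\<parallel> \<le> \<parallel>star x\<parallel>\<close>; then replace \<open>x\<close> by \<open>star x\<close>.\<close>

lemma norm_star [simp]: "norm (star x) = norm x"
proof -
  have *: "norm y \<le> norm (star y)" for y
  proof (cases "y = 0")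
    case False
    have "norm y * norm y \<le> norm (star y) * norm y"
      using norm_mult_ineq[of "star y" y] by (simp add: cstar_identity power2_eq_square)
    then show ?thesis using False by simp
  qed simp
  show ?thesis using *[of x] *[of "star x"] by (simp add: star_star)
qed

lemma bounded_linear_star: "bounded_linear (star :: 'a::cstar_algebra \<Rightarrow> 'a)"
  by (rule bounded_linear_intro[where K = 1]) (simp_all add: star_add)

lemma bounded_linear_scaleC: "bounded_linear (scaleC c :: 'a::cstar_algebra \<Rightarrow> 'a)"
  by (rule bounded_linear_intro[where K = "cmod c"])
    (simp_all add: scaleC_add_right scaleC_scaleR norm_scaleC mult.commute)

section \<open>Annihilators\<close>

text \<open>On sets closed under the involution \<open>perp\<close> is symmetric, so there \<open>annihilator\<close> is a
  polarity. Every annihilator is such a set, and by the C*-identity every annihilator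
  is the annihilator of such a set, which is why the usual calculus of polars applies.\<close>

definition star_closed :: "'a::cstar_algebra set \<Rightarrow> bool" where
  "star_closed S \<longleftrightarrow> (\<forall>x\<in>S. star x \<in> S)"

lemma annihilator_antimono: "S \<subseteq> T \<Longrightarrow> annihilator T \<subseteq> annihilator S"
  unfolding annihilator_def by blast

lemma annihilator_Un: "annihilator (S \<union> T) = annihilator S \<inter> annihilator T"
  unfolding annihilator_def by blast

lemma star_closed_annihilator [simp]: "star_closed (annihilator S)"
  unfolding star_closed_def annihilator_def perp_def by (simp add: star_star)

lemma star_closed_Un: "star_closed S \<Longrightarrow> star_closed T \<Longrightarrow> star_closed (S \<union> T)"
  unfolding star_closed_def by blast

lemma annihilatorD:
  assumes "b \<in> annihilator S" "s \<in> S"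
  shows "s * b = 0" "s * star b = 0"
  using assms unfolding annihilator_def perp_def by auto

lemma annihilatorD_star_closed:
  assumes "b \<in> annihilator S" "star_closed S" "s \<in> S"
  shows "b * s = 0" "star b * s = 0"
proof -
  have s: "star s \<in> S" using assms unfolding star_closed_def by blast
  show "b * s = 0" using annihilatorD(2)[OF assms(1) s]
    by (metis star_0 star_mult star_star)
  show "star b * s = 0" using annihilatorD(1)[OF assms(1) s]
    by (metis star_0 star_mult star_star)
qed

lemma subset_annihilator_annihilator:
  assumes "star_closed S"
  shows "S \<subseteq> annihilator (annihilator S)"
proof
  fix s assume s: "s \<in> S"
  then have s': "star s \<in> S" using assms unfolding star_closed_def by blast
  show "s \<in> annihilator (annihilator S)"
    using annihilatorD_star_closed[OF _ assms s] annihilatorD_star_closed[OF _ assms s']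
    unfolding annihilator_def[of "annihilator S"] perp_def by blast
qed

text \<open>Replacing \<open>s\<close> by \<open>star s * s\<close> turns an arbitrary set into a self-adjoint one with the same
  annihilator.\<close>

lemma perp_star_mult_self_iff: "perp (star s * s) b \<longleftrightarrow> perp s b"
proof -
  have "star s * s * c = 0 \<longleftrightarrow> s * c = 0" for c
  proof
    assume "star s * s * c = 0"
    then have "star (s * c) * (s * c) = 0" by (simp add: star_mult mult.assoc)
    then show "s * c = 0" by (simp only: star_mult_self_eq_0_iff)
  qed (simp add: mult.assoc)
  then show ?thesis unfolding perp_def by blast
qed

lemma annihilator_star_mult_self: "annihilator ((\<lambda>s. star s * s) ` S) = annihilator S"
  unfolding annihilator_def by (auto simp: perp_star_mult_self_iff)

lemma annihilator_triple: "annihilator (annihilator (annihilator S)) = annihilator S"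
proof
  let ?T = "(\<lambda>s. star s * s) ` S"
  have "star_closed ?T" unfolding star_closed_def by (auto simp: star_mult star_star)
  then have "?T \<subseteq> annihilator (annihilator ?T)" by (rule subset_annihilator_annihilator)
  from annihilator_antimono[OF this]
  show "annihilator (annihilator (annihilator S)) \<subseteq> annihilator S"
    by (simp add: annihilator_star_mult_self)
qed (simp add: subset_annihilator_annihilator)

lemma annihilator_in_annihilators [simp]: "annihilator S \<in> annihilators"
  unfolding annihilators_def by blast

lemma annihilators_bipolar: "C \<in> annihilators \<Longrightarrow> annihilator (annihilator C) = C"
  unfolding annihilators_def by (auto simp: annihilator_triple)

lemma annihilators_star_closed: "C \<in> annihilators \<Longrightarrow> star_closed C"
  unfolding annihilators_def by auto

lemma annihilators_Int:
  assumes "C \<in> annihilators" "D \<in> annihilators"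
  shows "C \<inter> D \<in> annihilators"
proof -
  have "C \<inter> D = annihilator (annihilator C \<union> annihilator D)"
    using assms by (simp add: annihilator_Un annihilators_bipolar)
  then show ?thesis by simp
qed

lemma bipolar_least:
  assumes "C \<in> annihilators" "S \<subseteq> C"
  shows "annihilator (annihilator S) \<subseteq> C"
  using annihilator_antimono[OF annihilator_antimono[OF assms(2)]] annihilators_bipolar[OF assms(1)]
  by simp

lemma annihilators_zero: "C \<in> annihilators \<Longrightarrow> 0 \<in> C"
  unfolding annihilators_def annihilator_def perp_def by auto

lemma annihilators_star: "C \<in> annihilators \<Longrightarrow> x \<in> C \<Longrightarrow> star x \<in> C"
  using annihilators_star_closed unfolding star_closed_def by blast

lemma annihilators_add: "C \<in> annihilators \<Longrightarrow> x \<in> C \<Longrightarrow> y \<in> C \<Longrightarrow> x + y \<in> C"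
  unfolding annihilators_def annihilator_def perp_def by (auto simp: star_add distrib_left)

lemma annihilators_scaleC: "C \<in> annihilators \<Longrightarrow> x \<in> C \<Longrightarrow> scaleC c x \<in> C"
  unfolding annihilators_def annihilator_def perp_def
  by (auto simp: star_scaleC scaleC_mult_right)

lemma annihilators_hereditary:
  assumes "C \<in> annihilators" "x \<in> C" "y \<in> C"
  shows "x * a * y \<in> C"
  using assms unfolding annihilators_def annihilator_def perp_def
  by (auto simp: star_mult mult.assoc[symmetric])

lemma annihilators_mult:
  assumes "C \<in> annihilators" "x \<in> C" "y \<in> C"
  shows "x * y \<in> C"
  using assms unfolding annihilators_def annihilator_def perp_def
  by (auto simp: star_mult mult.assoc[symmetric])

lemma closed_annihilator: "closed (annihilator (S :: 'a::cstar_algebra set))"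
proof -
  have "annihilator S = (\<Inter>s\<in>S. {b. s * b = 0} \<inter> {b. s * star b = 0})"
    unfolding annihilator_def perp_def by auto
  moreover have "closed ({b. s * b = 0} \<inter> {b. s * star b = 0})" for s :: 'a
    by (intro closed_Int closed_Collect_eq continuous_intros
        bounded_linear.continuous_on[OF bounded_linear_star])
  ultimately show ?thesis by auto
qed

lemma annihilators_zero_set: "{0 :: 'a::cstar_algebra} \<in> annihilators"
proof -
  have "x = 0" if "x \<in> annihilator UNIV" for x :: 'a
    using annihilatorD(2)[OF that UNIV_I, of x] by simp
  moreover have "(0 :: 'a) \<in> annihilator UNIV" unfolding annihilator_def perp_def by simp
  ultimately have "annihilator UNIV = {0 :: 'a}" by blast
  then show ?thesis using annihilator_in_annihilators[of "UNIV :: 'a set"] by simp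
qed

lemma Int_annihilator_zero:
  assumes "x \<in> C" "x \<in> annihilator C"
  shows "x = 0"
  using annihilatorD(2)[OF assms(2,1)] by simp

section \<open>The lattice of annihilators below a given one\<close>

lemma carrier_annihilators_below: "C \<in> carrier (annihilators_below B) \<longleftrightarrow> C \<in> annihilators \<and> C \<subseteq> B"
  unfolding annihilators_below_def by simp

context
  fixes B :: "'a::cstar_algebra set"
  assumes B: "B \<in> annihilators"
begin

lemma greatest_Int_annihilators_below:
  assumes "C \<in> carrier (annihilators_below B)" "D \<in> carrier (annihilators_below B)"
  shows "greatest (annihilators_below B) (C \<inter> D) (Lower (annihilators_below B) {C, D})"
  using assms annihilators_Int
  unfolding greatest_def Lower_def annihilators_below_def by auto

lemma least_bipolar_Un_annihilators_below:
  assumes "C \<in> carrier (annihilators_below B)" "D \<in> carrier (annihilators_below B)"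
  shows "least (annihilators_below B) (annihilator (annihilator (C \<union> D)))
    (Upper (annihilators_below B) {C, D})"
proof -
  have CD: "C \<in> annihilators" "C \<subseteq> B" "D \<in> annihilators" "D \<subseteq> B"
    using assms by (auto simp: carrier_annihilators_below)
  have 1: "annihilator (annihilator (C \<union> D)) \<subseteq> B"
    using CD B bipolar_least[of B "C \<union> D"] by auto
  have 2: "C \<union> D \<subseteq> annihilator (annihilator (C \<union> D))"
    using CD by (intro subset_annihilator_annihilator star_closed_Un annihilators_star_closed)
  show ?thesis
    using 1 2 CD bipolar_least[of _ "C \<union> D"]
    unfolding least_def Upper_def annihilators_below_def by auto
qed

lemma partial_order_annihilators_below: "partial_order (annihilators_below B)"
  unfolding annihilators_below_def by unfold_locales auto

lemma bounded_lattice_annihilators_below: "bounded_lattice (annihilators_below B)"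
proof -
  interpret partial_order "annihilators_below B" by (rule partial_order_annihilators_below)
  show ?thesis
  proof
    show "\<exists>s. least (annihilators_below B) s (Upper (annihilators_below B) {C, D})"
      if "C \<in> carrier (annihilators_below B)" "D \<in> carrier (annihilators_below B)" for C D
      using least_bipolar_Un_annihilators_below[OF that] by blast
    show "\<exists>i. greatest (annihilators_below B) i (Lower (annihilators_below B) {C, D})"
      if "C \<in> carrier (annihilators_below B)" "D \<in> carrier (annihilators_below B)" for C D
      using greatest_Int_annihilators_below[OF that] by blast
    have "least (annihilators_below B) {0} (carrier (annihilators_below B))"
      using B annihilators_zero annihilators_zero_set
      unfolding least_def annihilators_below_def by auto
    then show "\<exists>x. least (annihilators_below B) x (carrier (annihilators_below B))" by blast
    have "greatest (annihilators_below B) B (carrier (annihilators_below B))"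
      using B unfolding greatest_def annihilators_below_def by auto
    then show "\<exists>x. greatest (annihilators_below B) x (carrier (annihilators_below B))" by blast
  qed
qed

interpretation bounded_lattice "annihilators_below B"
  by (rule bounded_lattice_annihilators_below)

lemma meet_annihilators_below:
  assumes "C \<in> carrier (annihilators_below B)" "D \<in> carrier (annihilators_below B)"
  shows "C \<sqinter>\<^bsub>annihilators_below B\<^esub> D = C \<inter> D"
  using greatest_unique[OF _ greatest_Int_annihilators_below[OF assms]]
    inf_of_two_greatest[OF assms] unfolding meet_def by blast

lemma join_annihilators_below:
  assumes "C \<in> carrier (annihilators_below B)" "D \<in> carrier (annihilators_below B)"
  shows "C \<squnion>\<^bsub>annihilators_below B\<^esub> D = annihilator (annihilator (C \<union> D))"
  using least_unique[OF _ least_bipolar_Un_annihilators_below[OF assms]]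
    sup_of_two_least[OF assms] unfolding join_def by blast

lemma bottom_annihilators_below: "\<bottom>\<^bsub>annihilators_below B\<^esub> = {0}"
  using B annihilators_zero annihilators_zero_set
  by (intro bottom_eq[symmetric]) (auto simp: annihilators_below_def)

lemma top_annihilators_below: "\<top>\<^bsub>annihilators_below B\<^esub> = B"
  using B by (intro top_eq[symmetric]) (auto simp: annihilators_below_def)

lemma boolean_lattice_annihilators_below_iff:
  "boolean_lattice (annihilators_below B) \<longleftrightarrow>
    (\<forall>X\<in>carrier (annihilators_below B). \<forall>Y\<in>carrier (annihilators_below B).
      \<forall>Z\<in>carrier (annihilators_below B).
        X \<inter> annihilator (annihilator (Y \<union> Z)) =
          annihilator (annihilator ((X \<inter> Y) \<union> (X \<inter> Z)))) \<and>
    (\<forall>X\<in>carrier (annihilators_below B). \<exists>Y\<in>carrier (annihilators_below B).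
      X \<inter> Y = {0} \<and> annihilator (annihilator (X \<union> Y)) = B)"
proof -
  let ?L = "annihilators_below B"
  have join_closed: "annihilator (annihilator (Y \<union> Z)) \<in> carrier ?L"
    if "Y \<in> carrier ?L" "Z \<in> carrier ?L" for Y Z
    using least_closed[OF least_bipolar_Un_annihilators_below[OF that]] .
  have meet_closed: "Y \<inter> Z \<in> carrier ?L"
    if "Y \<in> carrier ?L" "Z \<in> carrier ?L" for Y Z
    using greatest_closed[OF greatest_Int_annihilators_below[OF that]] .
  have "boolean_lattice ?L \<longleftrightarrow> boolean_lattice_axioms ?L"
    using bounded_lattice_annihilators_below unfolding boolean_lattice_def by simp
  also have "\<dots> \<longleftrightarrow>
    (\<forall>X\<in>carrier ?L. \<forall>Y\<in>carrier ?L. \<forall>Z\<in>carrier ?L.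
      X \<sqinter>\<^bsub>?L\<^esub> (Y \<squnion>\<^bsub>?L\<^esub> Z) = (X \<sqinter>\<^bsub>?L\<^esub> Y) \<squnion>\<^bsub>?L\<^esub> (X \<sqinter>\<^bsub>?L\<^esub> Z)) \<and>
    (\<forall>X\<in>carrier ?L. \<exists>Y\<in>carrier ?L. X \<sqinter>\<^bsub>?L\<^esub> Y = \<bottom>\<^bsub>?L\<^esub> \<and> X \<squnion>\<^bsub>?L\<^esub> Y = \<top>\<^bsub>?L\<^esub>)"
    unfolding boolean_lattice_axioms_def by blast
  finally show ?thesis
    by (simp add: meet_annihilators_below join_annihilators_below join_closed meet_closed
        bottom_annihilators_below top_annihilators_below cong: ball_cong bex_cong)
qed

end

section \<open>Commutative annihilators have a Boolean lattice\<close>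

text \<open>The mechanism behind both Boolean laws. If \<open>t\<close> kills all products \<open>u * s\<close>, then the elements
  \<open>star u * star t * t * u\<close> are orthogonal to \<open>S\<close>; they also lie in the hereditary set \<open>U\<close>, which
  meets the annihilator of \<open>S\<close> trivially.\<close>

lemma mult_eq_0_if_mult_products_eq_0:
  assumes U: "U \<in> annihilators" and S: "star_closed S"
    and US: "U \<inter> annihilator S \<subseteq> {0}"
    and t: "\<And>u s. u \<in> U \<Longrightarrow> s \<in> S \<Longrightarrow> t * (u * s) = 0"
    and u: "u \<in> U"
  shows "t * u = 0"
proof -
  have *: "s * (star u * star t * t * u) = 0" if s: "s \<in> S" for s
  proof -
    have s': "star s \<in> S" using S s unfolding star_closed_def by blast
    have "star (t * (u * star s)) = 0" using t[OF u s'] by simp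
    then have "s * star u * star t = 0" unfolding star_mult star_star .
    then show ?thesis by (simp add: mult.assoc[symmetric])
  qed
  have "star u * (star t * t) * u \<in> U"
    using annihilators_hereditary[OF U annihilators_star[OF U u] u] .
  moreover have "star u * (star t * t) * u \<in> annihilator S"
    using * unfolding annihilator_def perp_def by (simp add: star_mult star_star mult.assoc)
  ultimately have "star u * (star t * t) * u = 0" using US by blast
  then have "star (t * u) * (t * u) = 0" by (simp add: star_mult mult.assoc)
  then show ?thesis by (simp only: star_mult_self_eq_0_iff)
qed

context
  fixes B :: "'a::cstar_algebra set"
  assumes B: "B \<in> annihilators"
    and comm: "\<And>x y. x \<in> B \<Longrightarrow> y \<in> B \<Longrightarrow> x * y = y * x"
begin

text \<open>In general an annihilator is only hereditary. Here \<open>star (x * b) = star x * star b\<close>, so that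
  multiplying by \<open>b\<close> on the right preserves both conditions in \<open>perp\<close>.\<close>

lemma annihilators_ideal_of_commutative:
  assumes C: "C \<in> annihilators" "C \<subseteq> B" and x: "x \<in> C" and b: "b \<in> B"
  shows "x * b \<in> C"
proof -
  have "perp t (x * b)" if t: "t \<in> annihilator C" for t
  proof -
    have "t * x = 0" "t * star x = 0"
      using annihilatorD_star_closed[OF t annihilators_star_closed[OF C(1)]]
        x annihilators_star[OF C(1)] by blast+
    moreover have "star (x * b) = star x * star b"
    proof -
      have "star x \<in> B" using annihilators_star[OF C(1) x] C(2) by blast
      then show ?thesis using comm[OF annihilators_star[OF B b]] by (simp add: star_mult)
    qed
    ultimately show ?thesis unfolding perp_def by (simp add: mult.assoc[symmetric])
  qed
  then have "x * b \<in> annihilator (annihilator C)" unfolding annihilator_def by blast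
  then show ?thesis by (simp add: annihilators_bipolar[OF C(1)])
qed

text \<open>The auxiliary lemma is applied with \<open>S = Y \<union> Z\<close> for distributivity, and with \<open>U = B\<close> and
  \<open>S\<close> the union of \<open>X\<close> and its relative annihilator for complements. Each time \<open>u * s = s * u\<close> lies in
  the intersection of two ideals, or in an ideal, that \<open>t\<close> annihilates.\<close>

lemma boolean_lattice_of_commutative: "boolean_lattice (annihilators_below B)"
proof (subst boolean_lattice_annihilators_below_iff[OF B], intro conjI ballI)
  fix X Y Z
  assume "X \<in> carrier (annihilators_below B)" "Y \<in> carrier (annihilators_below B)"
    "Z \<in> carrier (annihilators_below B)"
  then have X: "X \<in> annihilators" "X \<subseteq> B" and Y: "Y \<in> annihilators" "Y \<subseteq> B"
    and Z: "Z \<in> annihilators" "Z \<subseteq> B"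
    by (simp_all add: carrier_annihilators_below)
  let ?U = "X \<inter> annihilator (annihilator (Y \<union> Z))"
  let ?W = "(X \<inter> Y) \<union> (X \<inter> Z)"
  have YZ: "star_closed (Y \<union> Z)" and W: "star_closed ?W"
    using X Y Z by (intro star_closed_Un annihilators_star_closed annihilators_Int; simp)+
  have U: "?U \<in> annihilators" using X by (intro annihilators_Int) simp_all
  have UYZ: "?U \<inter> annihilator (Y \<union> Z) \<subseteq> {0}"
    using Int_annihilator_zero[of _ "annihilator (Y \<union> Z)"] by blast
  have "t * u = 0" if t: "t \<in> annihilator ?W" and u: "u \<in> ?U" for t u
  proof (rule mult_eq_0_if_mult_products_eq_0[OF U YZ UYZ _ u])
    fix u s assume u: "u \<in> ?U" and s: "s \<in> Y \<union> Z"
    then have "u \<in> B" "s \<in> B" using X Y Z by auto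
    then have "s * u = u * s" using comm by blast
    moreover have "u * s \<in> X"
      using annihilators_ideal_of_commutative[OF X _ \<open>s \<in> B\<close>] u by blast
    moreover have "s * u \<in> Y \<or> s * u \<in> Z"
      using annihilators_ideal_of_commutative[OF Y _ \<open>u \<in> B\<close>]
        annihilators_ideal_of_commutative[OF Z _ \<open>u \<in> B\<close>] s by auto
    ultimately have "u * s \<in> ?W" by auto
    then show "t * (u * s) = 0" using annihilatorD_star_closed(1)[OF t W] by blast
  qed
  then have "perp t u" if "t \<in> annihilator ?W" "u \<in> ?U" for t u
    using that annihilators_star[OF U] unfolding perp_def by blast
  then have "?U \<subseteq> annihilator (annihilator ?W)"
    unfolding annihilator_def[of "annihilator ?W"] by blast
  moreover have "?W \<subseteq> ?U" using subset_annihilator_annihilator[OF YZ] by blast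
  then have "annihilator (annihilator ?W) \<subseteq> ?U" by (rule bipolar_least[OF U])
  ultimately show "?U = annihilator (annihilator ?W)" by blast
next
  fix X
  assume "X \<in> carrier (annihilators_below B)"
  then have X: "X \<in> annihilators" "X \<subseteq> B" by (simp_all add: carrier_annihilators_below)
  let ?Y = "annihilator X \<inter> B"
  have Y: "?Y \<in> annihilators" "?Y \<subseteq> B" using B by (auto intro: annihilators_Int)
  have XY: "star_closed (X \<union> ?Y)"
    using X Y by (intro star_closed_Un annihilators_star_closed)
  have BXY: "B \<inter> annihilator (X \<union> ?Y) \<subseteq> {0}"
    using Int_annihilator_zero[of _ ?Y] by (auto simp: annihilator_Un)
  have "t * u = 0" if t: "t \<in> annihilator (X \<union> ?Y)" and u: "u \<in> B" for t u
  proof (rule mult_eq_0_if_mult_products_eq_0[OF B XY BXY _ u])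
    fix u s assume u: "u \<in> B" and s: "s \<in> X \<union> ?Y"
    have "s * u \<in> X \<union> ?Y"
      using annihilators_ideal_of_commutative[OF X _ u]
        annihilators_ideal_of_commutative[OF Y _ u] s by blast
    moreover have "s * u = u * s" using comm u s X by blast
    ultimately show "t * (u * s) = 0" using annihilatorD_star_closed(1)[OF t XY] by metis
  qed
  then have "perp t u" if "t \<in> annihilator (X \<union> ?Y)" "u \<in> B" for t u
    using that annihilators_star[OF B] unfolding perp_def by blast
  then have "B \<subseteq> annihilator (annihilator (X \<union> ?Y))"
    unfolding annihilator_def[of "annihilator (X \<union> ?Y)"] by blast
  moreover have "annihilator (annihilator (X \<union> ?Y)) \<subseteq> B"
    using X Y by (intro bipolar_least[OF B]) blast
  moreover have "X \<inter> ?Y = {0}"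
    using Int_annihilator_zero[of _ X] annihilators_zero[OF X(1)] annihilators_zero[OF Y(1)] by blast
  ultimately show "\<exists>Y\<in>carrier (annihilators_below B).
      X \<inter> Y = {0} \<and> annihilator (annihilator (X \<union> Y)) = B"
    using Y by (intro bexI[of _ ?Y]) (auto simp: carrier_annihilators_below)
qed

end

section \<open>Square-zero elements violate distributivity\<close>

text \<open>The model is the \<open>2 \<times> 2\<close> matrix algebra, where \<open>x\<close> is the matrix unit \<open>e\<^sub>2\<^sub>1\<close>: the coordinate
  lines \<open>C\<close>, \<open>D\<close> span the plane but meet the diagonal line \<open>E\<close> trivially. In general \<open>E\<close> is generated
  by the graph \<open>w = x\<^sup>*x + xx\<^sup>*x\<close> of \<open>x\<close> over the support of \<open>x\<^sup>*x\<close>; the element \<open>v\<close> spans the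
  orthogonal complement of that graph.\<close>

lemma square_zero_of_boolean_lattice:
  assumes B: "B \<in> annihilators" and bool: "boolean_lattice (annihilators_below B)"
    and x: "x \<in> B" and sq: "x * x = 0"
  shows "x = 0"
proof -
  define w where "w = star x * x + x * star x * x"
  define v where "v = x * star x - star x * x * star x"
  define C where "C = annihilator (annihilator {star x * x})"
  define D where "D = annihilator (annihilator {x * star x})"
  define E where "E = annihilator (annihilator {star w})"
  have sq': "star x * star x = 0" using sq by (metis star_0 star_mult)
  have xx: "x * (x * a) = 0" "star x * (star x * a) = 0" for a
    by (simp_all add: mult.assoc[symmetric] sq sq')
  have stars: "star x \<in> B" using annihilators_star[OF B x] .
  have sw: "star w = star x * x + star x * x * star x"
    unfolding w_def by (simp add: star_add star_mult star_star mult.assoc)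
  have sv: "star v = x * star x - x * star x * x"
    unfolding v_def by (simp add: star_diff star_mult star_star mult.assoc)
  have B_mem: "star x * x \<in> B" "x * star x \<in> B" "star w \<in> B"
    unfolding sw using stars x by (intro annihilators_mult[OF B] annihilators_add[OF B]; simp)+
  have carrier: "C \<in> carrier (annihilators_below B)" "D \<in> carrier (annihilators_below B)"
    "E \<in> carrier (annihilators_below B)"
    unfolding C_def D_def E_def carrier_annihilators_below
    using B_mem by (intro conjI annihilator_in_annihilators bipolar_least[OF B]; simp)+
  have stC: "star_closed {star x * x}" and stD: "star_closed {x * star x}"
    unfolding star_closed_def by (simp_all add: star_mult star_star)
  \<comment> \<open>The bipolar of \<open>{star w}\<close> is orthogonal to \<open>v * star v\<close>, as \<open>star w * v = 0\<close>.\<close>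
  have "star w * v = 0"
    unfolding sw v_def by (simp add: algebra_simps xx)
  then have "v * star v \<in> annihilator {star w}"
    unfolding annihilator_def perp_def by (simp add: star_mult star_star mult.assoc[symmetric])
  then have "v * star v * e = 0" if "e \<in> E" for e
    using annihilatorD(1)[OF that[unfolded E_def]] by blast
  then have "star (star v * e) * (star v * e) = 0" if "e \<in> E" for e
    using that by (simp add: star_mult star_star mult.assoc)
  then have vE: "star v * e = 0" if "e \<in> E" for e
    using that by (simp only: star_mult_self_eq_0_iff)
  have xC: "x * star x \<in> annihilator C" and xD: "star x * x \<in> annihilator D"
    unfolding C_def D_def annihilator_triple unfolding annihilator_def perp_def
    by (simp_all add: star_mult star_star mult.assoc xx)
  \<comment> \<open>On the diagonal \<open>E\<close> the two coordinates vanish simultaneously.\<close>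
  have graph: "x * star x * e = 0 \<longleftrightarrow> star x * x * e = 0" if e: "e \<in> E" for e
  proof -
    have "x * star x * e = x * (star x * x * e)"
      using vE[OF e] unfolding sv by (simp add: left_diff_distrib mult.assoc)
    moreover have "x * (star x * x * e) = 0 \<longleftrightarrow> star x * x * e = 0"
    proof
      assume "x * (star x * x * e) = 0"
      then have "star e * star x * (x * (star x * x * e)) = 0" by simp
      then have "star (star x * x * e) * (star x * x * e) = 0"
        by (simp add: star_mult star_star mult.assoc)
      then show "star x * x * e = 0" by (simp only: star_mult_self_eq_0_iff)
    qed simp
    ultimately show ?thesis by simp
  qed
  have Estar: "star e \<in> E" if "e \<in> E" for e
    using annihilators_star[OF annihilator_in_annihilators] that unfolding E_def by blast
  have "e = 0" if e: "e \<in> E" "e \<in> C" for e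
  proof -
    have "x * star x * e' = 0" if "e' \<in> C" for e'
      using annihilatorD_star_closed(1)[OF xC _ that] unfolding C_def by simp
    moreover have "star e \<in> C" using annihilators_star[OF annihilator_in_annihilators] e(2) unfolding C_def by blast
    ultimately have "e \<in> annihilator {star x * x}"
      using graph[OF e(1)] graph[OF Estar[OF e(1)]] e(2)
      unfolding annihilator_def perp_def by auto
    then show "e = 0" using Int_annihilator_zero e(2) unfolding C_def by blast
  qed
  moreover have "e = 0" if e: "e \<in> E" "e \<in> D" for e
  proof -
    have "star x * x * e' = 0" if "e' \<in> D" for e'
      using annihilatorD_star_closed(1)[OF xD _ that] unfolding D_def by simp
    moreover have "star e \<in> D" using annihilators_star[OF annihilator_in_annihilators] e(2) unfolding D_def by blast
    ultimately have "e \<in> annihilator {x * star x}"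
      using graph[OF e(1)] graph[OF Estar[OF e(1)]] e(2)
      unfolding annihilator_def perp_def by auto
    then show "e = 0" using Int_annihilator_zero e(2) unfolding D_def by blast
  qed
  ultimately have "(E \<inter> C) \<union> (E \<inter> D) \<subseteq> {0}" by blast
  then have "annihilator (annihilator ((E \<inter> C) \<union> (E \<inter> D))) \<subseteq> {0}"
    by (rule bipolar_least[OF annihilators_zero_set])
  moreover have "E \<inter> annihilator (annihilator (C \<union> D)) =
      annihilator (annihilator ((E \<inter> C) \<union> (E \<inter> D)))"
    using bool carrier unfolding boolean_lattice_annihilators_below_iff[OF B] by blast
  moreover have "w * star w \<in> E"
    using subset_annihilator_annihilator[of "{w * star w}"]
      annihilator_star_mult_self[of "{star w}"]
    unfolding E_def star_closed_def by (simp add: star_mult star_star)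
  moreover have "w * star w \<in> annihilator (annihilator (C \<union> D))"
  proof -
    have "star x * x \<in> C" "x * star x \<in> D"
      using subset_annihilator_annihilator[OF stC] subset_annihilator_annihilator[OF stD]
      unfolding C_def D_def by simp_all
    moreover have CD: "star_closed (C \<union> D)"
      unfolding C_def D_def by (intro star_closed_Un star_closed_annihilator)
    ultimately have "t * (star x * x) = 0" "t * (x * star x) = 0"
      if "t \<in> annihilator (C \<union> D)" for t
      using annihilatorD_star_closed(1)[OF that CD] by blast+
    then have "t * w = 0" if "t \<in> annihilator (C \<union> D)" for t
      using that unfolding w_def by (simp add: distrib_left mult.assoc[symmetric])
    then show ?thesis
      unfolding annihilator_def[of "annihilator (C \<union> D)"] perp_def
      by (simp add: star_mult star_star mult.assoc[symmetric])
  qed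
  ultimately have "w * star w = 0" by blast
  then have "star x * w = 0" by simp
  then have "star (star x * x) * (star x * x) = 0"
    unfolding w_def by (simp add: distrib_left xx star_mult star_star mult.assoc)
  then show "x = 0" by (simp only: star_mult_self_eq_0_iff)
qed

section \<open>The square root series\<close>

text \<open>The Taylor coefficients of \<open>\<surd>(1 - x)\<close> at \<open>0\<close>.\<close>

definition sqrt_coeff :: "nat \<Rightarrow> real" where
  "sqrt_coeff n = (1/2 gchoose n) * (-1) ^ n"

lemma sqrt_coeff_0 [simp]: "sqrt_coeff 0 = 1"
  by (simp add: sqrt_coeff_def)

lemma gchoose_neg_half_nonneg: "(-1) ^ n * (-1/2 gchoose n :: real) \<ge> 0"
proof -
  have "(-1) ^ n * (-1/2 gchoose n :: real) = pochhammer (1/2) n / fact n"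
    by (simp add: gbinomial_pochhammer)
  also have "\<dots> \<ge> 0" by (simp add: pochhammer_nonneg)
  finally show ?thesis .
qed

lemma sqrt_coeff_Suc_nonpos: "sqrt_coeff (Suc n) \<le> 0"
proof -
  have "sqrt_coeff (Suc n) = - ((1/2) / real (Suc n) * ((-1) ^ n * (-1/2 gchoose n)))"
    using gbinomial_factors[of "-1/2 :: real" n] by (simp add: sqrt_coeff_def)
  then show ?thesis using gchoose_neg_half_nonneg[of n] by simp
qed

lemma sum_sqrt_coeff: "(\<Sum>k\<le>n. sqrt_coeff k) = (-1) ^ n * (-1/2 gchoose n)"
  using gbinomial_sum_lower_neg[of "1/2 :: real" n] by (simp add: sqrt_coeff_def)

text \<open>All coefficients but the first are nonpositive, while the partial sums stay nonnegative.\<close>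

lemma sum_abs_sqrt_coeff_le: "(\<Sum>k<n. \<bar>sqrt_coeff (Suc k)\<bar>) \<le> 1"
proof -
  have "(\<Sum>k<n. \<bar>sqrt_coeff (Suc k)\<bar>) = 1 - (\<Sum>k\<le>n. sqrt_coeff k)"
    using sqrt_coeff_Suc_nonpos
    by (simp add: lessThan_Suc_atMost[symmetric] sum.lessThan_Suc_shift sum_negf abs_of_nonpos
        del: sum.lessThan_Suc)
  also have "\<dots> \<le> 1" using gchoose_neg_half_nonneg[of n] by (simp add: sum_sqrt_coeff)
  finally show ?thesis .
qed

lemma summable_abs_sqrt_coeff: "summable (\<lambda>n. \<bar>sqrt_coeff n\<bar>)"
proof -
  have "summable (\<lambda>n. \<bar>sqrt_coeff (Suc n)\<bar>)"
    using sum_abs_sqrt_coeff_le by (intro summableI_nonneg_bounded[of _ 1]) auto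
  then show ?thesis by (simp add: summable_Suc_iff[of "\<lambda>n. \<bar>sqrt_coeff n\<bar>"])
qed

definition sqrt_tail :: "nat \<Rightarrow> real" where
  "sqrt_tail n = (\<Sum>k. \<bar>sqrt_coeff (k + n)\<bar>)"

lemma sqrt_tail_tendsto_0: "sqrt_tail \<longlonglongrightarrow> 0"
  unfolding sqrt_tail_def by (rule suminf_exist_split2) (use summable_abs_sqrt_coeff in auto)

text \<open>The sum of the binomial series of \<open>\<surd>(1 - x)\<close>. As the coefficients are absolutely summable, it
  makes sense on the whole closed unit ball of a Banach algebra.\<close>

definition sqrt1m :: "'v::{real_normed_algebra_1, banach} \<Rightarrow> 'v" where
  "sqrt1m x = (\<Sum>n. sqrt_coeff n *\<^sub>R x ^ n)"

definition sqrt1m_partial :: "nat \<Rightarrow> 'v::real_normed_algebra_1 \<Rightarrow> 'v" where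
  "sqrt1m_partial n x = (\<Sum>k<n. sqrt_coeff k *\<^sub>R x ^ k)"

lemma norm_power_le_one: "norm (x :: 'v::real_normed_algebra_1) \<le> 1 \<Longrightarrow> norm (x ^ n) \<le> 1"
  using norm_power_ineq[of x n] power_le_one[of "norm x" n] by simp

lemma norm_sqrt_term_le:
  fixes x :: "'v::real_normed_algebra_1"
  assumes "norm x \<le> 1"
  shows "norm (sqrt_coeff n *\<^sub>R x ^ n) \<le> \<bar>sqrt_coeff n\<bar>"
  using mult_left_mono[OF norm_power_le_one[OF assms, of n], of "\<bar>sqrt_coeff n\<bar>"] by simp

lemma summable_norm_sqrt_terms:
  fixes x :: "'v::real_normed_algebra_1"
  assumes "norm x \<le> 1"
  shows "summable (\<lambda>n. norm (sqrt_coeff n *\<^sub>R x ^ n))"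
proof (rule summable_comparison_test'[OF summable_abs_sqrt_coeff, of 0])
  show "norm (norm (sqrt_coeff n *\<^sub>R x ^ n)) \<le> \<bar>sqrt_coeff n\<bar>" for n
    unfolding real_norm_def abs_norm_cancel by (rule norm_sqrt_term_le[OF assms])
qed

lemma sqrt1m_sums:
  fixes x :: "'v::{real_normed_algebra_1, banach}"
  assumes "norm x \<le> 1"
  shows "(\<lambda>n. sqrt_coeff n *\<^sub>R x ^ n) sums sqrt1m x"
  unfolding sqrt1m_def
  by (rule summable_sums[OF summable_norm_cancel[OF summable_norm_sqrt_terms[OF assms]]])

lemma sqrt1m_partial_tendsto:
  fixes x :: "'v::{real_normed_algebra_1, banach}"
  assumes "norm x \<le> 1"
  shows "(\<lambda>n. sqrt1m_partial n x) \<longlonglongrightarrow> sqrt1m x"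
  using sqrt1m_sums[OF assms] unfolding sums_def sqrt1m_partial_def .

lemma norm_sqrt1m_diff_partial:
  fixes x :: "'v::{real_normed_algebra_1, banach}"
  assumes "norm x \<le> 1"
  shows "norm (sqrt1m x - sqrt1m_partial n x) \<le> sqrt_tail n"
proof -
  have "sqrt1m x - sqrt1m_partial n x = (\<Sum>k. sqrt_coeff (k + n) *\<^sub>R x ^ (k + n))"
    unfolding sqrt1m_def sqrt1m_partial_def
    using suminf_minus_initial_segment[OF sums_summable[OF sqrt1m_sums[OF assms]], of n] by simp
  also have "norm \<dots> \<le> sqrt_tail n"
    unfolding sqrt_tail_def
    by (intro norm_suminf_le norm_sqrt_term_le assms summable_ignore_initial_segment
        summable_abs_sqrt_coeff)
  finally show ?thesis .
qed

text \<open>By Vandermonde's identity the Cauchy square of the coefficients is \<open>1, -1, 0, 0, \<dots>\<close>.\<close>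

lemma sqrt1m_square:
  fixes x :: "'v::{real_normed_algebra_1, banach}"
  assumes "norm x \<le> 1"
  shows "sqrt1m x * sqrt1m x = 1 - x"
proof -
  have "(\<lambda>n. \<Sum>i\<le>n. (sqrt_coeff i *\<^sub>R x ^ i) * (sqrt_coeff (n - i) *\<^sub>R x ^ (n - i))) sums
      (sqrt1m x * sqrt1m x)"
    unfolding sqrt1m_def
    by (rule Cauchy_product_sums[OF summable_norm_sqrt_terms[OF assms]
          summable_norm_sqrt_terms[OF assms]])
  moreover have "(\<Sum>i\<le>n. (sqrt_coeff i *\<^sub>R x ^ i) * (sqrt_coeff (n - i) *\<^sub>R x ^ (n - i))) =
      (if n = 0 then 1 else if n = 1 then - x else 0)" for n
  proof -
    have "(\<Sum>i\<le>n. (sqrt_coeff i *\<^sub>R x ^ i) * (sqrt_coeff (n - i) *\<^sub>R x ^ (n - i))) =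
        (\<Sum>i\<le>n. sqrt_coeff i * sqrt_coeff (n - i)) *\<^sub>R x ^ n"
      by (simp add: scaleR_sum_left power_add[symmetric] mult.commute)
    also have "(\<Sum>i\<le>n. sqrt_coeff i * sqrt_coeff (n - i)) =
        (\<Sum>i\<le>n. (1/2 gchoose i) * (1/2 gchoose (n - i))) * (-1) ^ n"
      unfolding sum_distrib_right
      by (intro sum.cong refl) (simp add: sqrt_coeff_def power_add[symmetric] mult.commute mult.left_commute)
    also have "\<dots> = (1 gchoose n) * (-1) ^ n"
      using gbinomial_Vandermonde[of "1/2 :: real" "1/2" n] by (simp add: atMost_atLeast0)
    also have "(1 gchoose n :: real) = (if n \<le> 1 then 1 else 0)"
      using binomial_gbinomial[of 1 n, where ?'a = real] by (auto simp: binomial_eq_0 le_Suc_eq not_le)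
    finally show ?thesis by auto
  qed
  ultimately have "(\<lambda>n. if n = 0 then 1 else if n = 1 then - x else 0) sums (sqrt1m x * sqrt1m x)"
    by simp
  moreover have "(\<lambda>n. if n = 0 then 1 else if n = 1 then - x else 0) sums
      (\<Sum>n\<in>{0, 1 :: nat}. if n = 0 then 1 else if n = 1 then - x else 0)"
    by (rule sums_finite) auto
  ultimately show ?thesis using sums_unique2 by fastforce
qed

lemma sqrt1m_nonneg_real:
  fixes x :: real
  assumes "0 \<le> x" "x \<le> 1"
  shows "sqrt1m x \<ge> 0"
proof -
  have "0 \<le> (\<Sum>k<n. sqrt_coeff k *\<^sub>R x ^ k)" if "n > 0" for n
  proof -
    obtain m where n: "n = Suc m" using \<open>n > 0\<close> gr0_implies_Suc by blast
    have "\<bar>sqrt_coeff (Suc k)\<bar> * x ^ Suc k \<le> \<bar>sqrt_coeff (Suc k)\<bar>" for k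
      using assms by (intro mult_left_le power_le_one) auto
    then have "(\<Sum>k<m. \<bar>sqrt_coeff (Suc k)\<bar> * x ^ Suc k) \<le> 1"
      using sum_abs_sqrt_coeff_le[of m] by (meson order_trans sum_mono)
    moreover have "sqrt_coeff (Suc k) * x ^ Suc k = - (\<bar>sqrt_coeff (Suc k)\<bar> * x ^ Suc k)" for k
      using sqrt_coeff_Suc_nonpos[of k] by (simp add: abs_of_nonpos)
    ultimately show ?thesis
      unfolding n sum.lessThan_Suc_shift by (simp add: sum_negf)
  qed
  then have "eventually (\<lambda>n. 0 \<le> (\<Sum>k<n. sqrt_coeff k *\<^sub>R x ^ k)) sequentially"
    using eventually_gt_at_top[of 0] by (rule eventually_mono[rotated])
  moreover have "(\<lambda>n. \<Sum>k<n. sqrt_coeff k *\<^sub>R x ^ k) \<longlonglongrightarrow> sqrt1m x"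
    using sqrt1m_sums[of x] assms unfolding sums_def by simp
  ultimately show ?thesis by (intro tendsto_lowerbound[OF _ _ sequentially_bot])
qed

text \<open>The only place where a sign has to be chosen: over the reals the series gives the nonnegative
  root.\<close>

lemma sqrt1m_one_minus_square_real:
  assumes "\<bar>x :: real\<bar> \<le> 1"
  shows "sqrt1m (1 - x\<^sup>2) = \<bar>x\<bar>"
proof -
  have x: "x\<^sup>2 \<le> 1" using assms by (simp add: abs_square_le_1)
  then have "norm (1 - x\<^sup>2) \<le> 1" by simp
  then have "(sqrt1m (1 - x\<^sup>2))\<^sup>2 = \<bar>x\<bar>\<^sup>2"
    using sqrt1m_square[of "1 - x\<^sup>2"] by (simp add: power2_eq_square[of "sqrt1m _"])
  then show ?thesis
    by (rule power2_eq_imp_eq) (use sqrt1m_nonneg_real[of "1 - x\<^sup>2"] x in simp_all)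
qed

lemma sqrt1m_partial_commute:
  "x * y = y * x \<Longrightarrow> sqrt1m_partial n x * y = y * sqrt1m_partial n x"
  unfolding sqrt1m_partial_def
  by (simp add: sum_distrib_left sum_distrib_right power_commuting_commutes)

lemma sqrt1m_commute:
  fixes x :: "'v::{real_normed_algebra_1, banach}"
  assumes "norm x \<le> 1" "x * y = y * x"
  shows "sqrt1m x * y = y * sqrt1m x"
proof (rule LIMSEQ_unique)
  show "(\<lambda>n. sqrt1m_partial n x * y) \<longlonglongrightarrow> sqrt1m x * y"
    by (intro tendsto_intros sqrt1m_partial_tendsto assms)
  show "(\<lambda>n. sqrt1m_partial n x * y) \<longlonglongrightarrow> y * sqrt1m x"
    unfolding sqrt1m_partial_commute[OF assms(2)] by (intro tendsto_intros sqrt1m_partial_tendsto assms)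
qed

text \<open>Used to make the unitary \<open>\<surd>(1 - h\<^sup>2) + \<i> h\<close> close to \<open>1\<close> for small \<open>h\<close>.\<close>

lemma norm_sqrt1m_minus_one_le:
  fixes x :: "'v::{real_normed_algebra_1, banach}"
  assumes "norm x \<le> 1"
  shows "norm (sqrt1m x - 1) \<le> norm x"
proof -
  have sm: "summable (\<lambda>n. sqrt_coeff n *\<^sub>R x ^ n)" using sqrt1m_sums[OF assms] sums_summable by blast
  have "(\<Sum>n. sqrt_coeff (Suc n) *\<^sub>R x ^ Suc n) = sqrt1m x - 1"
    using suminf_split_head[OF sm] by (simp add: sqrt1m_def)
  moreover have "norm (\<Sum>n. sqrt_coeff (Suc n) *\<^sub>R x ^ Suc n) \<le> (\<Sum>n. \<bar>sqrt_coeff (Suc n)\<bar> * norm x)"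
  proof (rule norm_suminf_le)
    show "norm (sqrt_coeff (Suc n) *\<^sub>R x ^ Suc n) \<le> \<bar>sqrt_coeff (Suc n)\<bar> * norm x" for n
    proof -
      have "norm (x * x ^ n) \<le> norm x * 1"
        using norm_mult_ineq[of x "x ^ n"] mult_left_mono[OF norm_power_le_one[OF assms, of n], of "norm x"]
        by simp
      then show ?thesis by (simp add: mult_left_mono)
    qed
    show "summable (\<lambda>n. \<bar>sqrt_coeff (Suc n)\<bar> * norm x)"
      using summable_abs_sqrt_coeff
      by (intro summable_mult2) (simp add: summable_Suc_iff[of "\<lambda>n. \<bar>sqrt_coeff n\<bar>"])
  qed
  moreover have "(\<Sum>n. \<bar>sqrt_coeff (Suc n)\<bar> * norm x) \<le> 1 * norm x"
  proof -
    have "summable (\<lambda>n. \<bar>sqrt_coeff (Suc n)\<bar>)"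
      using summable_abs_sqrt_coeff by (simp add: summable_Suc_iff[of "\<lambda>n. \<bar>sqrt_coeff n\<bar>"])
    then have "(\<Sum>n. \<bar>sqrt_coeff (Suc n)\<bar>) \<le> 1"
      "(\<Sum>n. \<bar>sqrt_coeff (Suc n)\<bar> * norm x) = (\<Sum>n. \<bar>sqrt_coeff (Suc n)\<bar>) * norm x"
      using sum_abs_sqrt_coeff_le by (auto intro: suminf_le_const simp: suminf_mult2)
    then show ?thesis using mult_right_mono[of _ 1 "norm x"] by simp
  qed
  ultimately show ?thesis by simp
qed

section \<open>Unital C*-algebras\<close>

class unital_cstar_algebra = cstar_algebra + real_normed_algebra_1

lemma star_one [simp]: "star (1 :: 'v::unital_cstar_algebra) = 1"
proof -
  have "(1 :: 'v) = star (star 1 * 1)" by (simp only: star_star mult_1_right)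
  also have "\<dots> = star 1" by (subst star_mult) (simp only: star_star mult_1_right)
  finally show ?thesis by (rule sym)
qed

lemma star_power: "star ((x :: 'v::unital_cstar_algebra) ^ n) = star x ^ n"
  by (induction n) (simp_all add: star_mult power_commutes)

lemma star_sqrt1m:
  fixes x :: "'v::unital_cstar_algebra"
  assumes "norm x \<le> 1"
  shows "star (sqrt1m x) = sqrt1m (star x)"
proof -
  have "star (sqrt1m x) = (\<Sum>n. star (sqrt_coeff n *\<^sub>R x ^ n))"
    unfolding sqrt1m_def
    by (rule bounded_linear.suminf[OF bounded_linear_star sums_summable[OF sqrt1m_sums[OF assms]]])
  then show ?thesis by (simp add: star_power sqrt1m_def)
qed

definition unitary :: "'v::unital_cstar_algebra \<Rightarrow> bool" where
  "unitary u \<longleftrightarrow> star u * u = 1 \<and> u * star u = 1"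

lemma unitary_one [simp]: "unitary 1"
  by (simp add: unitary_def)

lemma unitary_star: "unitary u \<Longrightarrow> unitary (star u)"
  by (simp add: unitary_def star_star)

lemma norm_unitary: "unitary u \<Longrightarrow> norm u = 1"
  using cstar_identity[of u] norm_ge_zero[of u]
  by (simp add: unitary_def power2_eq_1_iff del: norm_ge_zero)

lemma scaleC_one_mult: "scaleC c (1 :: 'v::unital_cstar_algebra) * x = scaleC c x"
  by (simp add: scaleC_mult_left)

lemma scaleC_one_inject: "scaleC c (1 :: 'v::unital_cstar_algebra) = scaleC d 1 \<longleftrightarrow> c = d"
proof
  assume "scaleC c (1 :: 'v) = scaleC d 1"
  then have "scaleC (c - d) (1 :: 'v) = 0"
    using scaleC_add_left[of c "- d" "1 :: 'v"] by (simp add: scaleC_minus_left)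
  then have "cmod (c - d) = 0" using norm_scaleC[of "c - d" "1 :: 'v"] by simp
  then show "c = d" by simp
qed simp

lemma unitary_scaleC_cis: "unitary u \<Longrightarrow> unitary (scaleC (cis t) u)"
  by (simp add: unitary_def star_scaleC scaleC_mult_left scaleC_mult_right scaleC_scaleC
      cis_cnj cis_mult)

text \<open>The element \<open>s = \<surd>(1 - b\<^sup>2)\<close> is self-adjoint and commutes with \<open>b\<close>, and \<open>s\<^sup>2 + b\<^sup>2 = 1\<close>; so \<open>s + \<i> b\<close>
  and \<open>s - \<i> b\<close> are adjoint and inverse to each other.\<close>

lemma unitary_sqrt1m_plus_ii:
  fixes b :: "'v::unital_cstar_algebra"
  assumes b: "star b = b" "norm b \<le> 1"
  shows "unitary (sqrt1m (b * b) + scaleC \<i> b)"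
    and "star (sqrt1m (b * b)) = sqrt1m (b * b)"
proof -
  have bb: "norm (b * b) \<le> 1"
    using norm_mult_ineq[of b b] mult_mono[of "norm b" 1 "norm b" 1] b by simp
  show s: "star (sqrt1m (b * b)) = sqrt1m (b * b)"
    using star_sqrt1m[OF bb] b by (simp add: star_mult)
  have c: "sqrt1m (b * b) * b = b * sqrt1m (b * b)"
    by (rule sqrt1m_commute[OF bb]) (simp add: mult.assoc)
  show "unitary (sqrt1m (b * b) + scaleC \<i> b)"
    using sqrt1m_square[OF bb]
    by (simp add: unitary_def star_add star_scaleC s b distrib_left distrib_right
        scaleC_mult_left scaleC_mult_right scaleC_scaleC c scaleC_minus_left
        left_diff_distrib right_diff_distrib scaleC_diff_right scaleC_add_right)
qed

text \<open>The element \<open>\<surd>(1 - b\<^sup>2)\<close> is the real part of a unitary, hence a contraction, and so is its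
  square. This replaces the positivity of \<open>b\<^sup>2\<close> and puts \<open>1 - b\<^sup>2\<close> into the domain of the series.\<close>

lemma norm_one_minus_square_le:
  fixes b :: "'v::unital_cstar_algebra"
  assumes b: "star b = b" "norm b \<le> 1"
  shows "norm (1 - b * b) \<le> 1"
proof -
  have bb: "norm (b * b) \<le> 1"
    using norm_mult_ineq[of b b] mult_mono[of "norm b" 1 "norm b" 1] b by simp
  let ?s = "sqrt1m (b * b)" let ?u = "?s + scaleC \<i> b"
  have "unitary ?u" and s: "star ?s = ?s" by (rule unitary_sqrt1m_plus_ii[OF b])+
  then have "norm ?u = 1" "norm (star ?u) = 1" by (simp_all add: norm_unitary del: norm_star add: norm_star)
  moreover have "2 *\<^sub>R ?s = ?u + star ?u"
    by (simp add: star_add star_scaleC s b scaleC_minus_left scaleR_2)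
  ultimately have "norm (2 *\<^sub>R ?s) \<le> 1 + 1" using norm_triangle_ineq[of ?u "star ?u"] by metis
  then have "norm ?s \<le> 1" by simp
  then have "norm (?s * ?s) \<le> 1"
    using norm_mult_ineq[of ?s ?s] mult_mono[of "norm ?s" 1 "norm ?s" 1] by simp
  then show ?thesis by (simp add: sqrt1m_square[OF bb])
qed

text \<open>The absolute value \<open>\<surd>(b\<^sup>2) = \<surd>(1 - (1 - b\<^sup>2))\<close> of a self-adjoint contraction.\<close>

definition cabs :: "'v::unital_cstar_algebra \<Rightarrow> 'v" where
  "cabs b = sqrt1m (1 - b * b)"

lemma cabs_square:
  assumes "star b = b" "norm b \<le> 1"
  shows "cabs b * cabs b = b * b"
  unfolding cabs_def using sqrt1m_square[OF norm_one_minus_square_le[OF assms]] by simp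

lemma cabs_commute:
  assumes "star b = b" "norm b \<le> 1"
  shows "cabs b * b = b * cabs b"
  unfolding cabs_def
  by (rule sqrt1m_commute[OF norm_one_minus_square_le[OF assms]])
    (simp add: left_diff_distrib right_diff_distrib mult.assoc)

text \<open>Let \<open>p, n\<close> be twice the positive and negative parts of \<open>b\<close>. As \<open>p * n = n * p = 0\<close>, the elements
  \<open>p * y * n\<close> and \<open>n * y * p\<close> have square zero; if they vanish, so does their difference,
  which is \<open>2 *\<^sub>R (b * y * cabs b - cabs b * y * b)\<close>.\<close>

lemma mult_cabs_swap:
  fixes b y :: "'v::unital_cstar_algebra"
  assumes b: "star b = b" "norm b \<le> 1"
    and nil: "\<And>z. (z = (cabs b + b) * y * (cabs b - b) \<or> z = (cabs b - b) * y * (cabs b + b)) \<Longrightarrow>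
      z * z = 0 \<Longrightarrow> z = 0"
  shows "b * y * cabs b = cabs b * y * b"
proof -
  let ?p = "cabs b + b" let ?n = "cabs b - b"
  have pn: "?p * ?n = 0" "?n * ?p = 0"
    using cabs_square[OF b] cabs_commute[OF b] by (simp_all add: algebra_simps)
  have "(?p * y * ?n) * (?p * y * ?n) = ?p * y * (?n * ?p) * y * ?n"
    "(?n * y * ?p) * (?n * y * ?p) = ?n * y * (?p * ?n) * y * ?p"
    by (simp_all only: mult.assoc)
  then have "?p * y * ?n = 0" "?n * y * ?p = 0"
    using nil[of "?p * y * ?n"] nil[of "?n * y * ?p"] by (simp_all add: pn)
  then have "?p * y * ?n - ?n * y * ?p = 0" by simp
  also have "?p * y * ?n - ?n * y * ?p = 2 *\<^sub>R (b * y * cabs b - cabs b * y * b)"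
    by (simp add: algebra_simps scaleR_2)
  finally show ?thesis by simp
qed

section \<open>Laurent polynomials in a unitary\<close>

definition upow :: "'v::unital_cstar_algebra \<Rightarrow> int \<Rightarrow> 'v" where
  "upow u k = (if k \<ge> 0 then u ^ nat k else star u ^ nat (- k))"

lemma upow_simps [simp]: "upow u 0 = 1" "upow u 1 = u" "upow u (-1) = star u"
  "upow u 2 = u * u" "upow u (-2) = star u * star u"
  by (simp_all add: upow_def power2_eq_square)

lemma upow_one [simp]: "upow 1 k = 1"
  by (simp add: upow_def)

lemma upow_plus_one:
  assumes "unitary u"
  shows "upow u (k + 1) = u * upow u k"
proof (cases "k \<ge> 0")
  case True
  then show ?thesis by (simp add: upow_def nat_add_distrib)
next
  case False
  define m where "m = nat (- k - 1)"
  have k: "k = - int (Suc m)" using False by (simp add: m_def)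
  have "u * (star u * star u ^ m) = star u ^ m"
    using assms by (simp add: unitary_def mult.assoc[symmetric])
  then show ?thesis unfolding k by (cases "m = 0") (simp_all add: upow_def nat_add_distrib)
qed

lemma upow_minus_one:
  assumes "unitary u"
  shows "upow u (k - 1) = star u * upow u k"
  using upow_plus_one[OF assms, of "k - 1"] assms by (simp add: unitary_def mult.assoc[symmetric])

lemma upow_add:
  assumes "unitary u"
  shows "upow u (k + l) = upow u k * upow u l"
proof (induction k rule: int_induct[where k = 0])
  case (step1 k)
  have "upow u (k + 1 + l) = upow u ((k + l) + 1)" by (simp add: algebra_simps)
  then show ?case using step1 by (simp only: upow_plus_one[OF assms] mult.assoc)
next
  case (step2 k)
  have "upow u (k - 1 + l) = upow u ((k + l) - 1)" by (simp add: algebra_simps)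
  then show ?case using step2 by (simp only: upow_minus_one[OF assms] mult.assoc)
qed simp

lemma upow_scaleC_cis:
  "upow (scaleC (cis t) u) k = scaleC (cis (of_int k * t)) (upow u k)"
proof -
  have *: "scaleC c x ^ n = scaleC (c ^ n) (x ^ n)" for c and x :: 'a and n
    by (induction n) (simp_all add: scaleC_mult_left scaleC_mult_right scaleC_scaleC mult.commute)
  have "cis t ^ nat k = cis (of_int k * t)" if "k \<ge> 0"
    using that by (simp add: Complex.DeMoivre)
  moreover have "cis (- t) ^ nat (- k) = cis (of_int k * t)" if "k < 0"
    using that by (simp add: Complex.DeMoivre)
  ultimately show ?thesis
    by (simp add: upow_def * star_scaleC cis_cnj)
qed

text \<open>The closure rule \<open>laurent_cong\<close> makes it enough to argue on unitaries, where \<open>star u\<close> is the inverse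
  of \<open>u\<close> and exponents add.\<close>

inductive laurent :: "('v::unital_cstar_algebra \<Rightarrow> 'v) \<Rightarrow> bool" where
  laurent_monomial: "laurent (\<lambda>u. scaleC c (upow u k))"
| laurent_add: "laurent F \<Longrightarrow> laurent G \<Longrightarrow> laurent (\<lambda>u. F u + G u)"
| laurent_cong: "laurent F \<Longrightarrow> (\<And>u. unitary u \<Longrightarrow> G u = F u) \<Longrightarrow> laurent G"

lemma laurent_mult:
  assumes "laurent F" "laurent G"
  shows "laurent (\<lambda>u. F u * G u)"
  using assms(1)
proof induction
  case (laurent_monomial c k)
  show ?case using assms(2)
  proof induction
    case (laurent_monomial d l)
    show ?case
      by (rule laurent_cong[OF laurent.laurent_monomial[of "d * c" "k + l"]])
        (simp add: upow_add scaleC_mult_left scaleC_mult_right scaleC_scaleC)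
  next
    case (laurent_add F G)
    from laurent.laurent_add[OF laurent_add.IH] show ?case by (simp add: distrib_left)
  next
    case (laurent_cong F G)
    show ?case by (rule laurent.laurent_cong[OF laurent_cong.IH]) (simp add: laurent_cong.hyps)
  qed
next
  case (laurent_add F G)
  from laurent.laurent_add[OF laurent_add.IH] show ?case by (simp add: distrib_right)
next
  case (laurent_cong F G)
  show ?case by (rule laurent.laurent_cong[OF laurent_cong.IH]) (simp add: laurent_cong.hyps)
qed

lemma laurent_const_one: "laurent (\<lambda>u. 1)"
  by (rule laurent_cong[OF laurent_monomial[of 1 0]]) simp

lemma laurent_scaleC: "laurent F \<Longrightarrow> laurent (\<lambda>u. scaleC c (F u))"
  using laurent_mult[OF laurent_monomial[of c 0]] by (simp add: scaleC_one_mult)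

lemma laurent_diff: "laurent F \<Longrightarrow> laurent G \<Longrightarrow> laurent (\<lambda>u. F u - G u)"
  using laurent_add[of F, OF _ laurent_scaleC[of G "-1"]] by (simp add: scaleC_minus_left)

lemma laurent_power: "laurent F \<Longrightarrow> laurent (\<lambda>u. F u ^ n)"
  by (induction n) (simp_all add: laurent_const_one laurent_mult)

lemma laurent_sum: "(\<And>i. i \<in> I \<Longrightarrow> laurent (F i)) \<Longrightarrow> laurent (\<lambda>u. \<Sum>i\<in>I. F i u)"
proof (induction I rule: infinite_finite_induct)
  case (insert i I)
  then show ?case using laurent_add[of "F i" "\<lambda>u. \<Sum>i\<in>I. F i u"] by simp
qed (use laurent_scaleC[OF laurent_const_one, of 0] in simp_all)

lemma laurent_sqrt1m_partial: "laurent F \<Longrightarrow> laurent (\<lambda>u. sqrt1m_partial n (F u))"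
  unfolding sqrt1m_partial_def scaleC_of_real[symmetric]
  by (intro laurent_sum laurent_scaleC laurent_power)

section \<open>Averages over the circle\<close>

text \<open>The average over the \<open>N\<close>-th roots of unity and their negatives. The negatives are included so that
  functions can be compared after pairing \<open>t\<close> with \<open>t + \<pi>\<close>.\<close>

definition circle_avg :: "nat \<Rightarrow> (real \<Rightarrow> 'b::real_vector) \<Rightarrow> 'b" where
  "circle_avg N f =
    (1 / (2 * real N)) *\<^sub>R (\<Sum>j<N. f (2 * pi * real j / real N) + f (2 * pi * real j / real N + pi))"

lemma circle_avg_add: "circle_avg N (\<lambda>t. f t + g t) = circle_avg N f + circle_avg N g"
  by (simp add: circle_avg_def sum.distrib scaleR_add_right algebra_simps)

lemma circle_avg_linear:
  assumes "linear h"
  shows "circle_avg N (\<lambda>t. h (f t)) = h (circle_avg N f)"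
  by (simp add: circle_avg_def linear_scale[OF assms] linear_sum[OF assms] linear_add[OF assms])

lemma circle_avg_diff: "circle_avg N (\<lambda>t. f t - g t) = circle_avg N f - circle_avg N g"
  by (simp add: circle_avg_def sum.distrib sum_subtractf algebra_simps)

lemma circle_avg_const: "N > 0 \<Longrightarrow> circle_avg N (\<lambda>t. c) = c"
  by (simp add: circle_avg_def scaleR_2[symmetric] sum_constant_scaleR)

lemma norm_circle_avg_le:
  assumes "N > 0" "\<And>t. norm (f t) \<le> C"
  shows "norm (circle_avg N f :: 'b::real_normed_vector) \<le> C"
proof -
  have "norm (\<Sum>j<N. f (2 * pi * real j / real N) + f (2 * pi * real j / real N + pi)) \<le>
      (\<Sum>j<N. C + C)"
    by (intro sum_norm_le norm_triangle_mono assms)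
  then have "1 / (2 * real N) * norm (\<Sum>j<N. f (2 * pi * real j / real N) + f (2 * pi * real j / real N + pi))
      \<le> 1 / (2 * real N) * (\<Sum>j<N. C + C)"
    by (intro mult_left_mono) simp_all
  also have "\<dots> = C" using assms(1) by (simp add: field_simps)
  finally show ?thesis by (simp add: circle_avg_def)
qed

lemma circle_avg_mono_pairs:
  fixes f g :: "real \<Rightarrow> real"
  assumes "\<And>t. f t + f (t + pi) \<le> g t + g (t + pi)"
  shows "circle_avg N f \<le> circle_avg N g"
  unfolding circle_avg_def by (intro scaleR_left_mono sum_mono assms) simp

lemma sum_roots_of_unity_power:
  assumes "m \<noteq> 0" "\<bar>m\<bar> < int N"
  shows "(\<Sum>j<N. cis (of_int m * (2 * pi * real j / real N))) = 0"
proof -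
  have N: "N > 0" using assms by (cases N) auto
  let ?z = "cis (2 * pi * of_int m / real N)"
  have "?z \<noteq> 1"
  proof
    assume "?z = 1"
    then have "cos (2 * pi * of_int m / real N) = 1" by (simp add: complex_eq_iff)
    then obtain l :: int where "2 * pi * of_int m / real N = 2 * pi * of_int l"
      unfolding cos_one_2pi_int by (auto simp: mult_ac)
    then have "real_of_int m = of_int l * of_int (int N)" using N by (simp add: field_simps)
    then have m: "m = l * int N" by (metis of_int_eq_iff of_int_mult)
    then have "l \<noteq> 0" using assms(1) by auto
    then have "\<bar>l\<bar> * int N \<ge> 1 * int N" by (intro mult_right_mono) auto
    then show False using assms(2) by (simp add: m abs_mult)
  qed
  moreover have "?z ^ N = 1"
    using N cis_multiple_2pi[of "of_int m"] by (simp add: Complex.DeMoivre)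
  moreover have "(\<Sum>j<N. cis (of_int m * (2 * pi * real j / real N))) = (\<Sum>j<N. ?z ^ j)"
    by (intro sum.cong refl) (simp add: Complex.DeMoivre field_simps)
  ultimately show ?thesis by (simp add: geometric_sum)
qed

lemma circle_avg_cis:
  assumes "\<bar>m\<bar> < int N"
  shows "circle_avg N (\<lambda>t. cis (of_int m * t)) = (if m = 0 then 1 else 0)"
proof (cases "m = 0")
  case True
  then show ?thesis using assms circle_avg_const[of N "1 :: complex"] by simp
next
  case False
  have *: "cis (of_int m * (t + pi)) = cis (of_int m * pi) * cis (of_int m * t)" for t
    by (simp add: cis_mult distrib_left add.commute)
  show ?thesis
    using False sum_roots_of_unity_power[OF False assms]
    unfolding circle_avg_def * by (simp add: sum.distrib sum_distrib_left[symmetric])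
qed

lemma circle_avg_cos:
  assumes "m > 0" "m < N"
  shows "circle_avg N (\<lambda>t. cos (real m * t)) = 0"
proof -
  have "circle_avg N (\<lambda>t. Re (cis (of_int (int m) * t))) = Re (circle_avg N (\<lambda>t. cis (of_int (int m) * t)))"
    by (rule circle_avg_linear) (simp add: bounded_linear.linear[OF bounded_linear_Re])
  then show ?thesis using circle_avg_cis[of "int m" N] assms by simp
qed

lemma linear_scaleC_left: "linear (\<lambda>c. scaleC c x)"
  by (rule linearI) (simp_all add: scaleC_add_left scaleC_scaleR_left)

text \<open>Averaging extracts Laurent coefficients; crucially the coefficient does not depend on the
  unitary, so that it can be computed at \<open>u = 1\<close>.\<close>

lemma laurent_coefficient:
  fixes F :: "'v::unital_cstar_algebra \<Rightarrow> 'v"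
  assumes "laurent F"
  shows "\<exists>a N0. \<forall>N\<ge>N0. \<forall>u. unitary u \<longrightarrow>
    circle_avg N (\<lambda>t. scaleC (cis (of_int k * t)) (F (scaleC (cis t) u))) = scaleC a (upow u (- k))"
  using assms
proof induction
  case (laurent_monomial c l)
  have "circle_avg N (\<lambda>t. scaleC (cis (of_int k * t)) (scaleC c (upow (scaleC (cis t) u) l))) =
      scaleC (if k + l = 0 then c else 0) (upow u (- k))" if "N \<ge> nat \<bar>k + l\<bar> + 1" for N and u :: 'v
  proof -
    have "circle_avg N (\<lambda>t. scaleC (cis (of_int k * t)) (scaleC c (upow (scaleC (cis t) u) l))) =
        circle_avg N (\<lambda>t. scaleC (cis (of_int (k + l) * t)) (scaleC c (upow u l)))"
      by (simp add: upow_scaleC_cis scaleC_scaleC cis_mult distrib_left distrib_right mult_ac flip: cis_mult)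
    also have "\<dots> = scaleC (circle_avg N (\<lambda>t. cis (of_int (k + l) * t))) (scaleC c (upow u l))"
      by (rule circle_avg_linear[OF linear_scaleC_left])
    also have "circle_avg N (\<lambda>t. cis (of_int (k + l) * t)) = (if k + l = 0 then 1 else 0)"
      by (rule circle_avg_cis) (use that in linarith)
    finally show ?thesis by (auto simp: add_eq_0_iff)
  qed
  then show ?case by blast
next
  case (laurent_add F G)
  from laurent_add.IH obtain a M b L where
    F: "\<forall>N\<ge>M. \<forall>u. unitary u \<longrightarrow>
    circle_avg N (\<lambda>t. scaleC (cis (of_int k * t)) (F (scaleC (cis t) u))) = scaleC a (upow u (- k))"
    and G: "\<forall>N\<ge>L. \<forall>u. unitary u \<longrightarrow>
    circle_avg N (\<lambda>t. scaleC (cis (of_int k * t)) (G (scaleC (cis t) u))) = scaleC b (upow u (- k))"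
    by blast
  show ?case
    by (rule exI[of _ "a + b"], rule exI[of _ "max M L"])
      (use F G in \<open>simp add: scaleC_add_right scaleC_add_left circle_avg_add\<close>)
next
  case (laurent_cong F G)
  then show ?case by (simp add: unitary_scaleC_cis)
qed

section \<open>A trigonometric wave and its absolute value\<close>

text \<open>Evaluated at \<open>e\<^sup>i\<^sup>t\<close> this is \<open>(sin t + sin 2t) / 2\<close>. The plain sine would not do: \<open>\<bar>sin t\<bar>\<close> has no
  first harmonic, and the averaged identity would be trivial.\<close>

definition wave :: "'v::unital_cstar_algebra \<Rightarrow> 'v" where
  "wave u = scaleC (- \<i> / 4) ((u - star u) + (u * u - star u * star u))"

lemma wave_selfadjoint: "star (wave u) = wave u"
proof -
  have "star (wave u) = scaleC (\<i> / 4) (- ((u - star u) + (u * u - star u * star u)))"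
    by (simp add: wave_def star_scaleC star_add star_diff star_mult star_star)
  also have "\<dots> = wave u" by (simp only: wave_def scaleC_minus_right scaleC_minus_left minus_divide_left[symmetric])
  finally show ?thesis .
qed

lemma norm_wave_le:
  assumes "unitary u"
  shows "norm (wave u) \<le> 1"
proof -
  have n: "norm u = 1" "norm (star u) = 1" using norm_unitary[OF assms] by simp_all
  have "norm (u * u) \<le> 1" "norm (star u * star u) \<le> 1"
    using norm_mult_ineq[of u u] norm_mult_ineq[of "star u" "star u"] n by simp_all
  then have "norm ((u - star u) + (u * u - star u * star u)) \<le> 4"
    using norm_triangle_ineq[of "u - star u" "u * u - star u * star u"]
      norm_triangle_ineq4[of u "star u"] norm_triangle_ineq4[of "u * u" "star u * star u"] n by linarith
  then show ?thesis by (simp add: wave_def norm_scaleC norm_divide)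
qed

lemma laurent_wave: "laurent wave"
  by (rule laurent_cong[where F = "\<lambda>u. scaleC (- \<i> / 4) ((scaleC 1 (upow u 1) - scaleC 1 (upow u (-1)))
        + (scaleC 1 (upow u 2) - scaleC 1 (upow u (-2))))"])
    (intro laurent_scaleC laurent_add laurent_diff laurent_monomial, simp add: wave_def)

text \<open>A Laurent polynomial approximating the absolute value of the wave uniformly on unitaries.\<close>

definition wave_abs_partial :: "nat \<Rightarrow> 'v::unital_cstar_algebra \<Rightarrow> 'v" where
  "wave_abs_partial n u = sqrt1m_partial n (1 - wave u * wave u)"

lemma laurent_wave_abs_partial: "laurent (wave_abs_partial n)"
  unfolding wave_abs_partial_def
  by (intro laurent_sqrt1m_partial laurent_diff laurent_const_one laurent_mult laurent_wave)

lemma norm_cabs_wave_diff_le: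
  assumes "unitary u"
  shows "norm (cabs (wave u) - wave_abs_partial n u) \<le> sqrt_tail n"
  unfolding cabs_def wave_abs_partial_def
  by (rule norm_sqrt1m_diff_partial[OF norm_one_minus_square_le[OF wave_selfadjoint norm_wave_le[OF assms]]])

abbreviation wave_real :: "real \<Rightarrow> real" where
  "wave_real t \<equiv> (sin t + sin (2 * t)) / 2"

abbreviation wave_abs_real :: "nat \<Rightarrow> real \<Rightarrow> real" where
  "wave_abs_real n t \<equiv> sqrt1m_partial n (1 - (wave_real t)\<^sup>2)"

lemma abs_wave_real_le: "\<bar>wave_real t\<bar> \<le> 1"
proof -
  have "\<bar>sin t + sin (2 * t)\<bar> \<le> 2"
    using abs_triangle_ineq[of "sin t" "sin (2 * t)"] abs_sin_le_one[of t] abs_sin_le_one[of "2 * t"]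
    by linarith
  then show ?thesis by simp
qed

lemma wave_abs_real_error: "\<bar>\<bar>wave_real t\<bar> - wave_abs_real n t\<bar> \<le> sqrt_tail n"
proof -
  have "(wave_real t)\<^sup>2 \<le> 1" using abs_wave_real_le[of t] by (simp only: abs_square_le_1)
  then have "norm (1 - (wave_real t)\<^sup>2) \<le> 1" unfolding real_norm_def by (simp del: power_divide)
  from norm_sqrt1m_diff_partial[OF this, of n] show ?thesis
    unfolding sqrt1m_one_minus_square_real[OF abs_wave_real_le] real_norm_def .
qed

lemma wave_at_scalar: "wave (scaleC (cis t) (1 :: 'v::unital_cstar_algebra)) = of_real (wave_real t)"
proof -
  have "wave (scaleC (cis t) (1 :: 'v)) =
      scaleC (- \<i> / 4 * ((cis t - cis (- t)) + (cis (2 * t) - cis (- (2 * t))))) 1"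
    by (simp add: wave_def star_scaleC cis_cnj scaleC_mult_left scaleC_scaleC cis_mult
        scaleC_add_left scaleC_diff_right scaleC_add_right left_diff_distrib right_diff_distrib
        distrib_left distrib_right scaleC_minus_left scaleC_minus_right
        scaleC_add_left[of _ "- _", simplified scaleC_minus_left, simplified])
  also have "- \<i> / 4 * ((cis t - cis (- t)) + (cis (2 * t) - cis (- (2 * t)))) =
      complex_of_real (wave_real t)"
    by (simp add: complex_eq_iff field_simps)
  finally have "wave (scaleC (cis t) (1 :: 'v)) = wave_real t *\<^sub>R 1"
    by (simp only: scaleC_of_real)
  then show ?thesis by (simp only: of_real_def)
qed

lemma wave_abs_partial_at_scalar:
  "wave_abs_partial n (scaleC (cis t) (1 :: 'v::unital_cstar_algebra)) = of_real (wave_abs_real n t)"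
proof -
  have "sqrt1m_partial n (1 - of_real r * of_real r :: 'v) = of_real (sqrt1m_partial n (1 - r\<^sup>2))" for r
    unfolding sqrt1m_partial_def by (simp add: scaleR_conv_of_real power2_eq_square)
  then show ?thesis unfolding wave_abs_partial_def wave_at_scalar .
qed

text \<open>Pairing \<open>t\<close> with \<open>t + \<pi>\<close> reverses the sign of \<open>cos t\<close> and turns \<open>\<bar>1 + 2 cos t\<bar>\<close> into
  \<open>\<bar>1 - 2 cos t\<bar>\<close>, so that a pair contributes at least \<open>sin\<^sup>2 2t / 2\<close> to the first Fourier
  coefficient of \<open>\<bar>wave_real\<bar>\<close>. This lower bound has a positive average.\<close>

lemma abs_wave_real_pair:
  "(1 - cos (4 * t)) / 8 + (1 - cos (4 * (t + pi))) / 8 \<le>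
    2 * cos t * \<bar>wave_real t\<bar> + 2 * cos (t + pi) * \<bar>wave_real (t + pi)\<bar>"
proof -
  let ?s = "sin t" let ?c = "cos t"
  have c: "\<bar>?c\<bar> \<le> 1" by simp
  have 1: "\<bar>wave_real t\<bar> = \<bar>?s\<bar> * \<bar>1 + 2 * ?c\<bar> / 2"
    unfolding sin_double by (simp add: abs_mult[symmetric] distrib_left mult_ac)
  have "sin (2 * (t + pi)) = sin (2 * t)"
    using sin_periodic[of "2 * t"] by (simp add: distrib_left)
  then have 2: "\<bar>wave_real (t + pi)\<bar> = \<bar>?s\<bar> * \<bar>1 - 2 * ?c\<bar> / 2"
    unfolding abs_mult[symmetric] sin_double
    by (simp add: sin_double right_diff_distrib mult_ac abs_minus_commute)
  have "cos (4 * (t + pi)) = cos (4 * t)"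
    using cos_periodic[of "4 * t + 2 * pi"] cos_periodic[of "4 * t"] by (simp add: algebra_simps)
  moreover have "1 - cos (4 * t) = 8 * (?s\<^sup>2 * ?c\<^sup>2)"
    using cos_double_sin[of "2 * t"] by (simp add: sin_double power_mult_distrib)
  moreover have "?s\<^sup>2 * (2 * ?c\<^sup>2) \<le> \<bar>?s\<bar> * (?c * (\<bar>1 + 2 * ?c\<bar> - \<bar>1 - 2 * ?c\<bar>))"
  proof (rule mult_mono)
    show "?s\<^sup>2 \<le> \<bar>?s\<bar>"
      using mult_left_mono[OF abs_sin_le_one[of t], of "\<bar>?s\<bar>"] by (simp add: power2_eq_square)
    have "2 * ?c\<^sup>2 \<le> 2 * \<bar>?c\<bar>"
      using mult_left_mono[OF c, of "\<bar>?c\<bar>"] by (simp add: power2_eq_square)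
    moreover have "2 * ?c\<^sup>2 \<le> 4 * ?c\<^sup>2" by simp
    moreover consider "?c > 1/2" | "?c < -1/2" | "- 1/2 \<le> ?c" "?c \<le> 1/2" by linarith
    then have "?c * (\<bar>1 + 2 * ?c\<bar> - \<bar>1 - 2 * ?c\<bar>) = 2 * \<bar>?c\<bar> \<or>
        ?c * (\<bar>1 + 2 * ?c\<bar> - \<bar>1 - 2 * ?c\<bar>) = 4 * ?c\<^sup>2"
      by cases (simp_all add: power2_eq_square)
    ultimately show "2 * ?c\<^sup>2 \<le> ?c * (\<bar>1 + 2 * ?c\<bar> - \<bar>1 - 2 * ?c\<bar>)" by metis
  qed simp_all
  ultimately show ?thesis unfolding 1 2 by (simp add: algebra_simps)
qed

lemma circle_avg_cos_abs_wave:
  assumes "N > 4"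
  shows "circle_avg N (\<lambda>t. 2 * cos t * \<bar>wave_real t\<bar>) \<ge> 1/8"
proof -
  have "circle_avg N (\<lambda>t. (1 - cos (4 * t)) / 8) = (1 - circle_avg N (\<lambda>t. cos (4 * t))) / 8"
    using circle_avg_linear[of "\<lambda>x :: real. x / 8" N "\<lambda>t. 1 - cos (4 * t)"]
      circle_avg_diff[of N "\<lambda>t. 1 :: real" "\<lambda>t. cos (4 * t)"] circle_avg_const[of N "1 :: real"] assms
    by (simp add: linear_iff add_divide_distrib)
  also have "\<dots> = 1/8" using circle_avg_cos[of 4 N] assms by simp
  finally show ?thesis
    using circle_avg_mono_pairs[of "\<lambda>t. (1 - cos (4 * t)) / 8"
        "\<lambda>t. 2 * cos t * \<bar>wave_real t\<bar>" N, OF abs_wave_real_pair] by simp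
qed

lemma circle_avg_wave_abs_real:
  assumes "N > 4"
  shows "circle_avg N (\<lambda>t. 2 * cos t * wave_abs_real n t) \<ge> 1/8 - 2 * sqrt_tail n"
    and "\<bar>circle_avg N (\<lambda>t. 2 * cos (of_int k * t) * wave_abs_real n t)\<bar> \<le> 2 * (1 + sqrt_tail n)"
proof -
  have "norm (circle_avg N (\<lambda>t. 2 * cos t * \<bar>wave_real t\<bar> - 2 * cos t * wave_abs_real n t)) \<le>
      2 * sqrt_tail n"
  proof (rule norm_circle_avg_le)
    fix t
    have "\<bar>cos t\<bar> * \<bar>\<bar>wave_real t\<bar> - wave_abs_real n t\<bar> \<le> 1 * sqrt_tail n"
      by (intro mult_mono wave_abs_real_error) auto
    moreover have "2 * cos t * \<bar>wave_real t\<bar> - 2 * cos t * wave_abs_real n t =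
        2 * (cos t * (\<bar>wave_real t\<bar> - wave_abs_real n t))"
      by (simp only: right_diff_distrib mult.assoc)
    ultimately show "norm (2 * cos t * \<bar>wave_real t\<bar> - 2 * cos t * wave_abs_real n t) \<le> 2 * sqrt_tail n"
      by (simp add: abs_mult)
  qed (use assms in simp)
  then show "circle_avg N (\<lambda>t. 2 * cos t * wave_abs_real n t) \<ge> 1/8 - 2 * sqrt_tail n"
    using circle_avg_cos_abs_wave[OF assms] unfolding circle_avg_diff real_norm_def by linarith
  have "norm (circle_avg N (\<lambda>t. 2 * cos (of_int k * t) * wave_abs_real n t)) \<le> 2 * (1 + sqrt_tail n)"
  proof (rule norm_circle_avg_le)
    fix t
    have "\<bar>wave_abs_real n t\<bar> \<le> 1 + sqrt_tail n"
      using abs_wave_real_le[of t] wave_abs_real_error[of t n] by linarith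
    then have "\<bar>cos (of_int k * t)\<bar> * \<bar>wave_abs_real n t\<bar> \<le> 1 * (1 + sqrt_tail n)"
      by (intro mult_mono) auto
    then show "norm (2 * cos (of_int k * t) * wave_abs_real n t) \<le> 2 * (1 + sqrt_tail n)"
      by (simp add: abs_mult)
  qed (use assms in simp)
  then show "\<bar>circle_avg N (\<lambda>t. 2 * cos (of_int k * t) * wave_abs_real n t)\<bar> \<le> 2 * (1 + sqrt_tail n)"
    by simp
qed

section \<open>Conjugation by a unitary\<close>

definition conj_pow :: "'v::unital_cstar_algebra \<Rightarrow> int \<Rightarrow> 'v \<Rightarrow> 'v" where
  "conj_pow u k y = upow u k * y * upow u (- k)"

text \<open>The identity of \<open>mult_cabs_swap\<close> for the waves in all rotations of \<open>u\<close>, ready to be averaged.\<close>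

definition abs_wave_swap :: "'v::unital_cstar_algebra \<Rightarrow> 'v \<Rightarrow> bool" where
  "abs_wave_swap u y \<longleftrightarrow> (\<forall>t. let b = wave (scaleC (cis t) u) in b * y * cabs b = cabs b * y * b)"

lemma circle_avg_sum: "circle_avg N (\<lambda>t. \<Sum>k\<in>K. f k t) = (\<Sum>k\<in>K. circle_avg N (f k))"
  by (induction K rule: infinite_finite_induct)
    (simp_all add: circle_avg_add, simp_all add: circle_avg_def)

lemma wave_eq_sum:
  "wave u = (\<Sum>k\<in>{1, -1, 2, -2}. scaleC (- \<i> / 4 * of_int (sgn k)) (upow u k))"
  by (simp add: wave_def scaleC_add_right scaleC_diff_right scaleC_minus_left)

text \<open>The average pairs each frequency \<open>k\<close> of the wave with the opposite frequency of \<open>F\<close>, which leaves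
  the conjugates of \<open>y\<close> by \<open>upow u k\<close>. Since the coefficients of the wave are odd in \<open>k\<close>, the
  coefficients \<open>a k\<close> and \<open>a (- k)\<close> enter through their sum.\<close>

lemma averaged_swap:
  fixes u y :: "'v::unital_cstar_algebra"
  assumes u: "unitary u" and N: "N > 0"
    and a: "\<And>k. k \<in> {1, -1, 2, -2} \<Longrightarrow> circle_avg N
      (\<lambda>t. scaleC (cis (of_int k * t)) (F (scaleC (cis t) u))) = scaleC (a k) (upow u (- k))"
  shows "circle_avg N (\<lambda>t. wave (scaleC (cis t) u) * y * F (scaleC (cis t) u) -
        F (scaleC (cis t) u) * y * wave (scaleC (cis t) u)) =
      scaleC (- \<i> / 4) (scaleC (a 1 + a (- 1)) (conj_pow u 1 y - conj_pow u (- 1) y) +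
        scaleC (a 2 + a (- 2)) (conj_pow u 2 y - conj_pow u (- 2) y))"
proof -
  let ?K = "{1, -1, 2, -2 :: int}"
  let ?c = "\<lambda>k :: int. - \<i> / 4 * of_int (sgn k)"
  let ?f = "\<lambda>k t. scaleC (cis (of_int k * t)) (F (scaleC (cis t) u))"
  have lin: "linear (\<lambda>z. scaleC c (v * z))" "linear (\<lambda>z. scaleC c (z * v))" for c and v :: 'v
    by (rule linearI; simp add: distrib_left distrib_right scaleC_add_right scaleC_scaleR)+
  have "wave (scaleC (cis t) u) * y * F (scaleC (cis t) u) =
      (\<Sum>k\<in>?K. scaleC (?c k) (upow u k * y * ?f k t))" for t
    unfolding wave_eq_sum sum_distrib_right
    by (intro sum.cong refl) (simp add: upow_scaleC_cis scaleC_mult_left scaleC_mult_right scaleC_scaleC)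
  then have 1: "circle_avg N (\<lambda>t. wave (scaleC (cis t) u) * y * F (scaleC (cis t) u)) =
      (\<Sum>k\<in>?K. scaleC (?c k) (upow u k * y * scaleC (a k) (upow u (- k))))"
    by (simp only: circle_avg_sum circle_avg_linear[OF lin(1)] a cong: sum.cong)
  have "F (scaleC (cis t) u) * y * wave (scaleC (cis t) u) =
      (\<Sum>k\<in>?K. scaleC (?c k) (?f k t * (y * upow u k)))" for t
    unfolding wave_eq_sum sum_distrib_left
    by (intro sum.cong refl) (simp add: upow_scaleC_cis scaleC_mult_left scaleC_mult_right scaleC_scaleC mult.assoc)
  then have 2: "circle_avg N (\<lambda>t. F (scaleC (cis t) u) * y * wave (scaleC (cis t) u)) =
      (\<Sum>k\<in>?K. scaleC (?c k) (scaleC (a k) (upow u (- k)) * (y * upow u k)))"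
    by (simp only: circle_avg_sum circle_avg_linear[OF lin(2)] a cong: sum.cong)
  show ?thesis
    unfolding circle_avg_diff 1 2 conj_pow_def
    by (simp add: scaleC_mult_left scaleC_mult_right scaleC_scaleC scaleC_add_right scaleC_add_left
        scaleC_diff_right scaleC_minus_left scaleC_minus_right mult.assoc distrib_left algebra_simps)
qed

lemma averaged_swap_norm_le:
  fixes u y :: "'v::unital_cstar_algebra"
  assumes u: "unitary u" and N: "N > 0" and swap: "abs_wave_swap u y"
  shows "norm (circle_avg N (\<lambda>t. wave (scaleC (cis t) u) * y * wave_abs_partial n (scaleC (cis t) u) -
        wave_abs_partial n (scaleC (cis t) u) * y * wave (scaleC (cis t) u))) \<le> 2 * norm y * sqrt_tail n"
proof (rule norm_circle_avg_le[OF N])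
  fix t
  let ?v = "scaleC (cis t) u"
  let ?d = "cabs (wave ?v) - wave_abs_partial n ?v"
  have v: "unitary ?v" by (rule unitary_scaleC_cis[OF u])
  have "wave ?v * y * cabs (wave ?v) = cabs (wave ?v) * y * wave ?v"
    using swap unfolding abs_wave_swap_def Let_def by blast
  then have "wave ?v * y * wave_abs_partial n ?v - wave_abs_partial n ?v * y * wave ?v =
      ?d * y * wave ?v - wave ?v * y * ?d"
    by (simp add: left_diff_distrib right_diff_distrib)
  also have "norm \<dots> \<le> sqrt_tail n * norm y * 1 + 1 * norm y * sqrt_tail n"
  proof (rule order_trans[OF norm_triangle_ineq4 add_mono])
    show "norm (?d * y * wave ?v) \<le> sqrt_tail n * norm y * 1"
      by (intro order_trans[OF norm_mult_ineq] order_trans[OF norm_mult_ineq[of ?d y]] mult_mono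
          norm_cabs_wave_diff_le[OF v] norm_wave_le[OF v] order_refl norm_ge_zero mult_nonneg_nonneg
          order_trans[OF norm_ge_zero norm_cabs_wave_diff_le[OF v]])
    show "norm (wave ?v * y * ?d) \<le> 1 * norm y * sqrt_tail n"
      by (intro order_trans[OF norm_mult_ineq] order_trans[OF norm_mult_ineq[of "wave ?v" y]] mult_mono
          norm_cabs_wave_diff_le[OF v] norm_wave_le[OF v] order_refl norm_ge_zero mult_nonneg_nonneg
          zero_le_one)
  qed
  also have "\<dots> = 2 * norm y * sqrt_tail n" by simp
  finally show "norm (wave ?v * y * wave_abs_partial n ?v - wave_abs_partial n ?v * y * wave ?v)
      \<le> 2 * norm y * sqrt_tail n" .
qed

text \<open>An approximate form of the averaged identity, with \<open>F\<close> the \<open>n\<close>-th partial sum for \<open>\<bar>b\<bar>\<close>. Its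
  constants come from Laurent coefficients and are therefore the same for all unitaries.\<close>

lemma swap_estimate:
  "\<exists>\<tau>\<^sub>1 \<tau>\<^sub>2 :: real. \<tau>\<^sub>1 \<ge> 1/8 - 2 * sqrt_tail n \<and> \<bar>\<tau>\<^sub>1\<bar> \<le> 2 * (1 + sqrt_tail n) \<and>
    \<bar>\<tau>\<^sub>2\<bar> \<le> 2 * (1 + sqrt_tail n) \<and>
    (\<forall>(u :: 'v::unital_cstar_algebra) y. unitary u \<and> abs_wave_swap u y \<longrightarrow>
      norm (\<tau>\<^sub>1 *\<^sub>R (conj_pow u 1 y - conj_pow u (-1) y) + \<tau>\<^sub>2 *\<^sub>R (conj_pow u 2 y - conj_pow u (-2) y))
        \<le> 8 * norm y * sqrt_tail n)"
proof -
  let ?F = "wave_abs_partial n :: 'v \<Rightarrow> 'v"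
  have "\<forall>k. \<exists>a N0. \<forall>N\<ge>N0. \<forall>u. unitary u \<longrightarrow>
    circle_avg N (\<lambda>t. scaleC (cis (of_int k * t)) (?F (scaleC (cis t) u))) = scaleC a (upow u (- k))"
    using laurent_coefficient[OF laurent_wave_abs_partial] by blast
  then obtain a N0 where a: "\<And>k N u. N \<ge> N0 k \<Longrightarrow> unitary u \<Longrightarrow>
    circle_avg N (\<lambda>t. scaleC (cis (of_int k * t)) (?F (scaleC (cis t) u))) = scaleC (a k) (upow u (- k))"
    by metis
  define N where "N = N0 1 + N0 (-1) + N0 2 + N0 (-2) + 5"
  have N: "N > 4" "N > 0" and N_ge: "\<And>k. k \<in> {1, -1, 2, -2} \<Longrightarrow> N \<ge> N0 k"
    unfolding N_def by auto
  \<comment> \<open>The coefficients are read off at the unitary \<open>1\<close>, where everything is a real number.\<close>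
  have \<tau>: "a k + a (- k) = of_real (circle_avg N (\<lambda>t. 2 * cos (of_int k * t) * wave_abs_real n t))"
    if k: "k \<in> {1, 2}" for k
  proof -
    have "scaleC (a k + a (- k)) (1 :: 'v) =
        circle_avg N (\<lambda>t. scaleC (cis (of_int k * t)) (?F (scaleC (cis t) 1)) +
          scaleC (cis (of_int (- k) * t)) (?F (scaleC (cis t) 1)))"
      using a[of k N 1] a[of "- k" N 1] N_ge[of k] N_ge[of "- k"] k
      by (auto simp: circle_avg_add scaleC_add_left)
    also have "(\<lambda>t. scaleC (cis (of_int k * t)) (?F (scaleC (cis t) 1)) +
          scaleC (cis (of_int (- k) * t)) (?F (scaleC (cis t) 1))) =
        (\<lambda>t. of_real (2 * cos (of_int k * t) * wave_abs_real n t))"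
    proof
      fix t
      have "scaleC (cis (of_int k * t)) (?F (scaleC (cis t) 1)) +
          scaleC (cis (of_int (- k) * t)) (?F (scaleC (cis t) 1)) =
          scaleC (cis (of_int k * t) + cis (- (of_int k * t))) (of_real (wave_abs_real n t))"
        by (simp only: wave_abs_partial_at_scalar scaleC_add_left of_int_minus mult_minus_left)
      also have "cis (of_int k * t) + cis (- (of_int k * t)) = complex_of_real (2 * cos (of_int k * t))"
        by (simp add: complex_eq_iff)
      also have "scaleC (complex_of_real (2 * cos (of_int k * t))) (of_real (wave_abs_real n t) :: 'v) =
          of_real (2 * cos (of_int k * t) * wave_abs_real n t)"
        by (subst scaleC_of_real) (simp only: scaleR_conv_of_real of_real_mult)
      finally show "scaleC (cis (of_int k * t)) (?F (scaleC (cis t) 1)) +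
          scaleC (cis (of_int (- k) * t)) (?F (scaleC (cis t) 1)) =
          of_real (2 * cos (of_int k * t) * wave_abs_real n t)" .
    qed
    also have "circle_avg N (\<lambda>t. of_real (2 * cos (of_int k * t) * wave_abs_real n t) :: 'v) =
        of_real (circle_avg N (\<lambda>t. 2 * cos (of_int k * t) * wave_abs_real n t))"
      by (rule circle_avg_linear) (rule bounded_linear.linear[OF bounded_linear_of_real])
    also have "(of_real (circle_avg N (\<lambda>t. 2 * cos (of_int k * t) * wave_abs_real n t)) :: 'v) =
        scaleC (of_real (circle_avg N (\<lambda>t. 2 * cos (of_int k * t) * wave_abs_real n t))) 1"
      unfolding scaleC_of_real unfolding of_real_def ..
    finally show ?thesis unfolding scaleC_one_inject .
  qed
  let ?\<tau> = "\<lambda>k :: int. circle_avg N (\<lambda>t. 2 * cos (of_int k * t) * wave_abs_real n t)"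
  have "norm (?\<tau> 1 *\<^sub>R (conj_pow u 1 y - conj_pow u (-1) y) +
      ?\<tau> 2 *\<^sub>R (conj_pow u 2 y - conj_pow u (-2) y)) \<le> 8 * norm y * sqrt_tail n"
    if u: "unitary u" and swap: "abs_wave_swap u y" for u y :: 'v
  proof -
    have "circle_avg N (\<lambda>t. wave (scaleC (cis t) u) * y * ?F (scaleC (cis t) u) -
        ?F (scaleC (cis t) u) * y * wave (scaleC (cis t) u)) =
      scaleC (- \<i> / 4) (scaleC (a 1 + a (- 1)) (conj_pow u 1 y - conj_pow u (- 1) y) +
        scaleC (a 2 + a (- 2)) (conj_pow u 2 y - conj_pow u (- 2) y))"
      by (rule averaged_swap[OF u N(2) a[OF N_ge u]])
    then show ?thesis
      using averaged_swap_norm_le[OF u N(2) swap, of n] \<tau>[of 1] \<tau>[of 2]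
      by (simp add: norm_scaleC scaleC_of_real norm_divide)
  qed
  then show ?thesis
    using circle_avg_wave_abs_real(1)[OF N(1), of n] circle_avg_wave_abs_real(2)[OF N(1), of 1 n]
      circle_avg_wave_abs_real(2)[OF N(1), of 2 n]
    by (intro exI[of _ "?\<tau> 1"] exI[of _ "?\<tau> 2"]) simp
qed

text \<open>Bounded sequences of constants have convergent subsequences, and the errors tend to \<open>0\<close>.\<close>

lemma swap_identity:
  "\<exists>\<tau>\<^sub>1 \<tau>\<^sub>2 :: real. \<tau>\<^sub>1 > 0 \<and>
    (\<forall>(u :: 'v::unital_cstar_algebra) y. unitary u \<and> abs_wave_swap u y \<longrightarrow>
      \<tau>\<^sub>1 *\<^sub>R (conj_pow u 1 y - conj_pow u (-1) y) + \<tau>\<^sub>2 *\<^sub>R (conj_pow u 2 y - conj_pow u (-2) y) = 0)"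
proof -
  define Q where "Q n \<tau>\<^sub>1 \<tau>\<^sub>2 \<longleftrightarrow> \<tau>\<^sub>1 \<ge> 1/8 - 2 * sqrt_tail n \<and> \<bar>\<tau>\<^sub>1\<bar> \<le> 2 * (1 + sqrt_tail n) \<and>
    \<bar>\<tau>\<^sub>2\<bar> \<le> 2 * (1 + sqrt_tail n) \<and>
    (\<forall>(u :: 'v) y. unitary u \<and> abs_wave_swap u y \<longrightarrow>
      norm (\<tau>\<^sub>1 *\<^sub>R (conj_pow u 1 y - conj_pow u (-1) y) + \<tau>\<^sub>2 *\<^sub>R (conj_pow u 2 y - conj_pow u (-2) y))
        \<le> 8 * norm y * sqrt_tail n)" for n and \<tau>\<^sub>1 \<tau>\<^sub>2 :: real
  have "\<forall>n. \<exists>\<tau>\<^sub>1 \<tau>\<^sub>2. Q n \<tau>\<^sub>1 \<tau>\<^sub>2" unfolding Q_def by (intro allI swap_estimate)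
  from choice[OF this] obtain \<tau>\<^sub>1 where "\<forall>n. \<exists>\<tau>\<^sub>2. Q n (\<tau>\<^sub>1 n) \<tau>\<^sub>2" ..
  from choice[OF this] obtain \<tau>\<^sub>2 where Q: "\<forall>n. Q n (\<tau>\<^sub>1 n) (\<tau>\<^sub>2 n)" ..
  have pos: "\<tau>\<^sub>1 n \<ge> 1/8 - 2 * sqrt_tail n" and bd1: "\<bar>\<tau>\<^sub>1 n\<bar> \<le> 2 * (1 + sqrt_tail n)"
    and bd2: "\<bar>\<tau>\<^sub>2 n\<bar> \<le> 2 * (1 + sqrt_tail n)" for n
    using spec[OF Q, of n] unfolding Q_def by simp_all
  have est: "norm (\<tau>\<^sub>1 n *\<^sub>R (conj_pow u 1 y - conj_pow u (-1) y) +
      \<tau>\<^sub>2 n *\<^sub>R (conj_pow u 2 y - conj_pow u (-2) y)) \<le> 8 * norm y * sqrt_tail n"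
    if "unitary u" "abs_wave_swap u y" for n and u y :: 'v
    using spec[OF Q, of n] that unfolding Q_def by blast
  obtain K where K: "\<And>n. \<bar>sqrt_tail n\<bar> \<le> K"
    using convergent_imp_Bseq[OF convergentI[OF sqrt_tail_tendsto_0]] unfolding Bseq_def by auto
  have "norm (\<tau>\<^sub>1 n, \<tau>\<^sub>2 n) \<le> 4 * (1 + K)" for n
  proof -
    have "norm (\<tau>\<^sub>1 n, \<tau>\<^sub>2 n) \<le> 2 * (1 + sqrt_tail n) + 2 * (1 + sqrt_tail n)"
      by (rule order_trans[OF norm_Pair_le]) (unfold real_norm_def, rule add_mono[OF bd1 bd2])
    also have "\<dots> \<le> 4 * (1 + K)" using abs_le_D1[OF K[of n]] by simp
    finally show ?thesis .
  qed
  then have "bounded (range (\<lambda>n. (\<tau>\<^sub>1 n, \<tau>\<^sub>2 n)))" unfolding bounded_iff by blast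
  then obtain l r where r: "strict_mono (r :: nat \<Rightarrow> nat)"
    and l: "((\<lambda>n. (\<tau>\<^sub>1 n, \<tau>\<^sub>2 n)) \<circ> r) \<longlonglongrightarrow> l"
    using bounded_imp_convergent_subsequence by blast
  have l1: "(\<lambda>n. \<tau>\<^sub>1 (r n)) \<longlonglongrightarrow> fst l" and l2: "(\<lambda>n. \<tau>\<^sub>2 (r n)) \<longlonglongrightarrow> snd l"
    using tendsto_fst[OF l] tendsto_snd[OF l] by (simp_all add: o_def)
  have tail: "(\<lambda>n. sqrt_tail (r n)) \<longlonglongrightarrow> 0"
    using LIMSEQ_subseq_LIMSEQ[OF sqrt_tail_tendsto_0 r] by (simp add: o_def)
  have "(\<lambda>n. 1/8 - 2 * sqrt_tail (r n)) \<longlonglongrightarrow> 1/8 - 2 * 0" by (intro tendsto_intros tail)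
  then have "1/8 - 2 * 0 \<le> fst l" using l1 by (rule LIMSEQ_le) (intro exI[of _ 0] allI impI pos)
  moreover have "fst l *\<^sub>R (conj_pow u 1 y - conj_pow u (-1) y) +
      snd l *\<^sub>R (conj_pow u 2 y - conj_pow u (-2) y) = 0"
    if "unitary u" "abs_wave_swap u y" for u y :: 'v
  proof -
    have "(\<lambda>n. \<tau>\<^sub>1 (r n) *\<^sub>R (conj_pow u 1 y - conj_pow u (-1) y) +
        \<tau>\<^sub>2 (r n) *\<^sub>R (conj_pow u 2 y - conj_pow u (-2) y)) \<longlonglongrightarrow> 0"
    proof (rule Lim_null_comparison)
      show "(\<lambda>n. 8 * norm y * sqrt_tail (r n)) \<longlonglongrightarrow> 0"
        by (rule tendsto_mult_right_zero[OF tail])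
    qed (intro always_eventually allI est that)
    moreover have "(\<lambda>n. \<tau>\<^sub>1 (r n) *\<^sub>R (conj_pow u 1 y - conj_pow u (-1) y) +
        \<tau>\<^sub>2 (r n) *\<^sub>R (conj_pow u 2 y - conj_pow u (-2) y)) \<longlonglongrightarrow>
        fst l *\<^sub>R (conj_pow u 1 y - conj_pow u (-1) y) + snd l *\<^sub>R (conj_pow u 2 y - conj_pow u (-2) y)"
      by (intro tendsto_intros l1 l2)
    ultimately show ?thesis by (rule LIMSEQ_unique[symmetric])
  qed
  ultimately show ?thesis by (intro exI[of _ "fst l"] exI[of _ "snd l"]) simp
qed

text \<open>An isometry \<open>W\<close> with \<open>(W - 1)\<^sup>2 x = 0\<close> fixes \<open>x\<close>: otherwise \<open>W\<^sup>n x = x + n (W x - x)\<close> would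
  be unbounded.\<close>

lemma isometry_fixed_if_square_difference_zero:
  fixes W :: "'b::real_normed_vector \<Rightarrow> 'b"
  assumes W: "linear W" "\<And>z. norm (W z) = norm z"
    and x: "W (W x - x) = W x - x"
  shows "W x = x"
proof -
  have iter: "(W ^^ n) x = x + real n *\<^sub>R (W x - x)" for n
  proof (induction n)
    case (Suc n)
    have "(W ^^ Suc n) x = W x + real n *\<^sub>R W (W x - x)"
      using Suc by (simp add: linear_add[OF W(1)] linear_scale[OF W(1)])
    then show ?case using x by (simp add: scaleR_add_left)
  qed simp
  have norm_iter: "norm ((W ^^ n) x) = norm x" for n
    by (induction n) (simp_all add: W(2))
  have "real n * norm (W x - x) \<le> 2 * norm x" for n
  proof -
    have "real n *\<^sub>R (W x - x) = (W ^^ n) x - x" by (simp add: iter)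
    then have "norm (real n *\<^sub>R (W x - x)) \<le> norm x + norm x"
      using norm_triangle_ineq4[of "(W ^^ n) x" x] norm_iter[of n] by metis
    then show ?thesis by simp
  qed
  then have "norm (W x - x) \<le> 0"
    using reals_Archimedean3[of "norm (W x - x)"] by (meson not_le less_le_trans)
  then show ?thesis by simp
qed

lemma commute_if_conj_eq:
  assumes "unitary u" "u * y * star u = y"
  shows "u * y = y * u"
proof -
  have "u * y = u * y * (star u * u)" using assms(1) by (simp add: unitary_def)
  also have "\<dots> = u * y * star u * u" by (simp only: mult.assoc)
  finally show ?thesis by (simp only: assms(2))
qed

lemma norm_mult_unitary:
  assumes "unitary (u :: 'v::unital_cstar_algebra)"
  shows "norm (u * z) = norm z" "norm (z * u) = norm z"
proof -
  have n: "norm u = 1" "norm (star u) = 1" using norm_unitary[OF assms] by simp_all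
  have "norm (star u * (u * z)) \<le> norm (u * z)" "norm ((z * u) * star u) \<le> norm (z * u)"
    "norm (u * z) \<le> norm z" "norm (z * u) \<le> norm z"
    using norm_mult_ineq[of "star u" "u * z"] norm_mult_ineq[of "z * u" "star u"]
      norm_mult_ineq[of u z] norm_mult_ineq[of z u] n by simp_all
  moreover have "star u * (u * z) = z" using assms by (simp add: unitary_def mult.assoc[symmetric])
  moreover have "(z * u) * star u = z" using assms by (simp add: unitary_def mult.assoc)
  ultimately show "norm (u * z) = norm z" "norm (z * u) = norm z" by simp_all
qed

lemma norm_conj_diff_le:
  assumes u: "unitary (u :: 'v::unital_cstar_algebra)"
  shows "norm (u * z * star u - z) \<le> 2 * norm (u - 1) * norm z"
proof -
  have "u * z * star u - z = (u * z - z * u) * star u"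
    using u by (simp add: left_diff_distrib mult.assoc unitary_def)
  then have "norm (u * z * star u - z) = norm (u * z - z * u)"
    by (simp add: norm_mult_unitary[OF unitary_star[OF u]])
  also have "u * z - z * u = (u - 1) * z - z * (u - 1)" by (simp add: algebra_simps)
  also have "norm \<dots> \<le> norm (u - 1) * norm z + norm z * norm (u - 1)"
    by (intro order_trans[OF norm_triangle_ineq4] add_mono norm_mult_ineq)
  finally show ?thesis by (simp add: mult.commute)
qed

lemma norm_star_minus_one: "norm (star u - 1 :: 'v::unital_cstar_algebra) = norm (u - 1)"
  using norm_star[of "u - 1"] by (simp add: star_diff)

text \<open>For \<open>u\<close> near \<open>1\<close> the conjugation \<open>W\<close> is near the identity, so \<open>W + 1\<close> is injective.\<close>

lemma zero_if_conj_eq_minus: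
  assumes u: "unitary (u :: 'v::unital_cstar_algebra)" and close: "norm (u - 1) < 1"
    and z: "u * z * star u = - z"
  shows "z = 0"
proof (rule ccontr)
  assume "z \<noteq> 0"
  have "norm (u * z * star u - z) = 2 * norm z"
    using norm_scaleR[of 2 "- z"] by (simp add: z scaleR_2)
  then have "2 * norm z \<le> 2 * norm (u - 1) * norm z" using norm_conj_diff_le[OF u, of z] by simp
  then show False using close \<open>z \<noteq> 0\<close> by simp
qed

text \<open>The averaged identity says \<open>(W - W\<^sup>-\<^sup>1) (\<tau>\<^sub>1 + \<tau>\<^sub>2 (W + W\<^sup>-\<^sup>1)) y = 0\<close>. If \<open>\<tau>\<^sub>1 + 2 \<tau>\<^sub>2 \<noteq> 0\<close> then the
  second factor is injective for \<open>W\<close> near the identity; otherwise it is a multiple of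
  \<open>W\<^sup>-\<^sup>1 (W - 1)\<^sup>2\<close>. Both times it remains to cancel powers of \<open>W - 1\<close> and the injective \<open>W + 1\<close>.\<close>

lemma swap_imp_commute_near_one:
  "\<exists>\<delta>>0. \<forall>(u :: 'v::unital_cstar_algebra) y.
    unitary u \<and> abs_wave_swap u y \<and> norm (u - 1) < \<delta> \<longrightarrow> u * y = y * u"
proof -
  obtain \<tau>\<^sub>1 \<tau>\<^sub>2 where \<tau>\<^sub>1: "\<tau>\<^sub>1 > 0" and id: "\<And>(u :: 'v) y. unitary u \<Longrightarrow> abs_wave_swap u y \<Longrightarrow>
      \<tau>\<^sub>1 *\<^sub>R (conj_pow u 1 y - conj_pow u (-1) y) + \<tau>\<^sub>2 *\<^sub>R (conj_pow u 2 y - conj_pow u (-2) y) = 0"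
    using swap_identity[where 'v = 'v] by blast
  define \<sigma> where "\<sigma> = \<tau>\<^sub>1 + 2 * \<tau>\<^sub>2"
  define \<delta> where "\<delta> = (if \<sigma> = 0 then 1 else min 1 (\<bar>\<sigma>\<bar> / (4 * \<bar>\<tau>\<^sub>2\<bar> + 1)))"
  have "\<delta> > 0" unfolding \<delta>_def by (auto intro!: divide_pos_pos add_nonneg_pos)
  moreover have "u * y = y * u"
    if u: "unitary u" and swap: "abs_wave_swap u y" and close: "norm (u - 1) < \<delta>" for u y :: 'v
  proof (rule commute_if_conj_eq[OF u])
    define W where "W z = u * z * star u" for z
    define W' where "W' z = star u * z * u" for z
    have close1: "norm (u - 1) < 1" using close unfolding \<delta>_def by (auto split: if_splits)
    have W_lin: "linear W" unfolding W_def by (rule linearI) (simp_all add: distrib_left distrib_right)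
    have W_norm: "norm (W z) = norm z" for z
      unfolding W_def by (simp add: norm_mult_unitary[OF u] norm_mult_unitary[OF unitary_star[OF u]])
    have W_add: "W (a + b) = W a + W b" and W_diff: "W (a - b) = W a - W b"
      and W_scale: "W (r *\<^sub>R a) = r *\<^sub>R W a" for a b r
      using linear_add[OF W_lin] linear_diff[OF W_lin] linear_scale[OF W_lin] by blast+
    have WW': "W (W' z) = z" and W'W: "W' (W z) = z" for z
    proof -
      have "W (W' z) = (u * star u) * z * (u * star u)" "W' (W z) = (star u * u) * z * (star u * u)"
        unfolding W_def W'_def by (simp_all only: mult.assoc)
      then show "W (W' z) = z" "W' (W z) = z" using u by (simp_all add: unitary_def)
    qed
    have cp: "conj_pow u 1 y = W y" "conj_pow u (-1) y = W' y" "conj_pow u 2 y = W (W y)"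
      "conj_pow u (-2) y = W' (W' y)"
      unfolding conj_pow_def W_def W'_def by (simp_all add: mult.assoc)
    have eq: "\<tau>\<^sub>1 *\<^sub>R (W y - W' y) + \<tau>\<^sub>2 *\<^sub>R (W (W y) - W' (W' y)) = 0"
      using id[OF u swap] unfolding cp .
    show "W y = y"
    proof (cases "\<sigma> = 0")
      case False
      define Z where "Z = W y - W' y"
      have W'_diff: "W' (a - b) = W' a - W' b" for a b
        unfolding W'_def by (simp add: left_diff_distrib right_diff_distrib)
      have "W Z + W' Z = W (W y) - W' (W' y)"
        unfolding Z_def by (simp add: W_diff W'_diff WW' W'W)
      then have "\<tau>\<^sub>1 *\<^sub>R Z + \<tau>\<^sub>2 *\<^sub>R (W Z + W' Z) = 0" using eq unfolding Z_def by simp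
      moreover have "\<tau>\<^sub>1 *\<^sub>R Z + \<tau>\<^sub>2 *\<^sub>R (W Z + W' Z) =
          \<sigma> *\<^sub>R Z + \<tau>\<^sub>2 *\<^sub>R ((W Z - Z) + (W' Z - Z))"
        unfolding \<sigma>_def by (simp add: algebra_simps scaleR_2[symmetric])
      ultimately have "\<sigma> *\<^sub>R Z = - (\<tau>\<^sub>2 *\<^sub>R ((W Z - Z) + (W' Z - Z)))"
        by (simp only: add_eq_0_iff2)
      then have "\<bar>\<sigma>\<bar> * norm Z = \<bar>\<tau>\<^sub>2\<bar> * norm ((W Z - Z) + (W' Z - Z))"
        by (metis norm_minus_cancel norm_scaleR)
      moreover have "norm ((W Z - Z) + (W' Z - Z)) \<le> 4 * norm (u - 1) * norm Z"
      proof -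
        have "norm (W Z - Z) \<le> 2 * norm (u - 1) * norm Z" unfolding W_def by (rule norm_conj_diff_le[OF u])
        moreover have "norm (W' Z - Z) \<le> 2 * norm (u - 1) * norm Z"
          using norm_conj_diff_le[OF unitary_star[OF u], of Z]
          unfolding W'_def by (simp add: star_star norm_star_minus_one)
        ultimately show ?thesis using norm_triangle_ineq[of "W Z - Z" "W' Z - Z"] by linarith
      qed
      from mult_left_mono[OF this, of "\<bar>\<tau>\<^sub>2\<bar>"]
      have "\<bar>\<tau>\<^sub>2\<bar> * norm ((W Z - Z) + (W' Z - Z)) \<le> (4 * \<bar>\<tau>\<^sub>2\<bar> * norm (u - 1)) * norm Z"
        by (simp add: mult_ac)
      ultimately have le: "\<bar>\<sigma>\<bar> * norm Z \<le> (4 * \<bar>\<tau>\<^sub>2\<bar> * norm (u - 1)) * norm Z" by simp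
      have "norm (u - 1) < \<bar>\<sigma>\<bar> / (4 * \<bar>\<tau>\<^sub>2\<bar> + 1)" using close False unfolding \<delta>_def by simp
      then have "norm (u - 1) * (4 * \<bar>\<tau>\<^sub>2\<bar> + 1) < \<bar>\<sigma>\<bar>"
        by (subst (asm) pos_less_divide_eq) (auto intro: add_nonneg_pos)
      then have "4 * \<bar>\<tau>\<^sub>2\<bar> * norm (u - 1) < \<bar>\<sigma>\<bar>"
        using order_le_less_trans[of "4 * \<bar>\<tau>\<^sub>2\<bar> * norm (u - 1)" "norm (u - 1) * (4 * \<bar>\<tau>\<^sub>2\<bar> + 1)"]
        by (simp add: algebra_simps)
      then have "\<not> \<bar>\<sigma>\<bar> \<le> 4 * \<bar>\<tau>\<^sub>2\<bar> * norm (u - 1)" by simp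
      then have "norm Z \<le> 0" using le mult_right_le_imp_le not_le by blast
      then have "Z = 0" by simp
      then have "W (W y) = y" using WW'[of y] unfolding Z_def by simp
      then have "W (W y - y) = - (W y - y)" by (simp add: W_diff)
      then have "W y - y = 0" unfolding W_def by (rule zero_if_conj_eq_minus[OF u close1])
      then show ?thesis by simp
    next
      case True
      then have \<tau>: "\<tau>\<^sub>1 = - 2 * \<tau>\<^sub>2" "\<tau>\<^sub>2 \<noteq> 0" using \<tau>\<^sub>1 unfolding \<sigma>_def by auto
      \<comment> \<open>Up to a factor, the identity now reads \<open>(W - W\<^sup>-\<^sup>1) (W - 2 + W\<^sup>-\<^sup>1) y = 0\<close>; multiply by \<open>W\<^sup>2\<close> to
        get \<open>(W + 1) (W - 1)\<^sup>3 y = 0\<close>.\<close>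
      have "\<tau>\<^sub>2 *\<^sub>R ((W (W y) - W' (W' y)) - 2 *\<^sub>R (W y - W' y)) = 0"
        using eq unfolding \<tau>(1) by (simp add: algebra_simps)
      then have "(W (W y) - W' (W' y)) - 2 *\<^sub>R (W y - W' y) = 0" using \<tau>(2) by simp
      then have "W (W ((W (W y) - W' (W' y)) - 2 *\<^sub>R (W y - W' y))) = 0"
        using linear_0[OF W_lin] by simp
      then have poly: "W (W (W (W y))) - y - 2 *\<^sub>R (W (W (W y)) - W y) = 0"
        by (simp add: W_diff W_scale WW')
      define d1 where "d1 = W y - y"
      define d2 where "d2 = W d1 - d1"
      define d3 where "d3 = W d2 - d2"
      have "W d3 = - d3"
        using poly unfolding d3_def d2_def d1_def
        by (simp add: W_diff W_add algebra_simps scaleR_2 add_eq_0_iff eq_neg_iff_add_eq_0)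
      then have "d3 = 0" unfolding W_def by (rule zero_if_conj_eq_minus[OF u close1])
      then have "W (W d1 - d1) = W d1 - d1" unfolding d3_def d2_def by simp
      then have "W d1 = d1" by (rule isometry_fixed_if_square_difference_zero[OF W_lin W_norm])
      then have "W (W y - y) = W y - y" unfolding d1_def .
      then show "W y = y" by (rule isometry_fixed_if_square_difference_zero[OF W_lin W_norm])
    qed
  qed
  ultimately show ?thesis by blast
qed

section \<open>C*-subalgebras without nilpotent elements are commutative\<close>

lemma scaleC_cancel:
  assumes "scaleC c x = scaleC c y" "c \<noteq> 0"
  shows "x = y"
proof -
  have "scaleC (inverse c * c) x = scaleC (inverse c * c) y"
    using assms(1) by (simp only: scaleC_scaleC[symmetric])
  then show ?thesis using assms(2) by simp
qed

text \<open>Functions of elements of \<open>B\<close> may involve the unit and leave \<open>B\<close>, but they still multiply \<open>B\<close>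
  into itself.\<close>

definition idealizer :: "'v::semigroup_mult set \<Rightarrow> 'v set" where
  "idealizer B = {v. \<forall>y\<in>B. v * y \<in> B \<and> y * v \<in> B}"

context
  fixes B :: "'v::unital_cstar_algebra set"
  assumes add: "\<And>x y. x \<in> B \<Longrightarrow> y \<in> B \<Longrightarrow> x + y \<in> B"
    and scaleC: "\<And>c x. x \<in> B \<Longrightarrow> scaleC c x \<in> B"
    and mult: "\<And>x y. x \<in> B \<Longrightarrow> y \<in> B \<Longrightarrow> x * y \<in> B"
    and star: "\<And>x. x \<in> B \<Longrightarrow> star x \<in> B"
    and closed: "closed B"
    and reduced: "\<And>x. x \<in> B \<Longrightarrow> x * x = 0 \<Longrightarrow> x = 0"
begin

lemma idealizer_mem:
  "x \<in> B \<Longrightarrow> x \<in> idealizer B"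
  "1 \<in> idealizer B"
  "v \<in> idealizer B \<Longrightarrow> scaleC c v \<in> idealizer B"
  "v \<in> idealizer B \<Longrightarrow> w \<in> idealizer B \<Longrightarrow> v + w \<in> idealizer B"
  "v \<in> idealizer B \<Longrightarrow> w \<in> idealizer B \<Longrightarrow> v * w \<in> idealizer B"
proof -
  show "x \<in> B \<Longrightarrow> x \<in> idealizer B" unfolding idealizer_def using mult by blast
  show "1 \<in> idealizer B" unfolding idealizer_def by simp
  show "v \<in> idealizer B \<Longrightarrow> scaleC c v \<in> idealizer B"
    unfolding idealizer_def by (simp add: scaleC scaleC_mult_left scaleC_mult_right)
  assume v: "v \<in> idealizer B" and w: "w \<in> idealizer B"
  then show "v + w \<in> idealizer B"
    unfolding idealizer_def by (simp add: add distrib_left distrib_right)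
  have "v * (w * y) \<in> B \<and> (y * v) * w \<in> B" if "y \<in> B" for y
    using v w that unfolding idealizer_def by blast
  then show "v * w \<in> idealizer B" unfolding idealizer_def by (simp add: mult.assoc)
qed

lemma idealizer_diff: "v \<in> idealizer B \<Longrightarrow> w \<in> idealizer B \<Longrightarrow> v - w \<in> idealizer B"
  using idealizer_mem(4)[of v "scaleC (-1) w"] idealizer_mem(3)[of w "-1"]
  by (simp add: scaleC_minus_left)

lemma idealizer_star:
  assumes "v \<in> idealizer B"
  shows "star v \<in> idealizer B"
proof -
  have "star v * y \<in> B \<and> y * star v \<in> B" if "y \<in> B" for y
  proof -
    have "v * star y \<in> B" "star y * v \<in> B" using assms star[OF that] unfolding idealizer_def by blast+
    then show ?thesis using star[of "v * star y"] star[of "star y * v"] by (simp add: star_mult star_star)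
  qed
  then show ?thesis unfolding idealizer_def by blast
qed

lemma idealizer_sqrt1m:
  assumes v: "v \<in> idealizer B" and n: "norm v \<le> 1"
  shows "sqrt1m v \<in> idealizer B"
proof -
  have "sqrt1m_partial k v \<in> idealizer B" for k
  proof (induction k)
    case 0
    show ?case using idealizer_mem(3)[OF idealizer_mem(2), of 0] by (simp add: sqrt1m_partial_def)
  next
    case (Suc k)
    have "v ^ k \<in> idealizer B" by (induction k) (simp_all add: idealizer_mem v)
    then show ?case
      using idealizer_mem(4)[OF Suc idealizer_mem(3)[of "v ^ k" "of_real (sqrt_coeff k)"]]
      by (simp add: sqrt1m_partial_def scaleC_of_real)
  qed
  then have mem: "sqrt1m_partial k v * y \<in> B" "y * sqrt1m_partial k v \<in> B" if "y \<in> B" for k y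
    using that unfolding idealizer_def by blast+
  have "sqrt1m v * y \<in> B \<and> y * sqrt1m v \<in> B" if y: "y \<in> B" for y
  proof
    show "sqrt1m v * y \<in> B"
      by (rule closed_sequentially[OF closed mem(1)[OF y]])
        (rule tendsto_mult_right[OF sqrt1m_partial_tendsto[OF n]])
    show "y * sqrt1m v \<in> B"
      by (rule closed_sequentially[OF closed mem(2)[OF y]])
        (rule tendsto_mult_left[OF sqrt1m_partial_tendsto[OF n]])
  qed
  then show ?thesis unfolding idealizer_def by blast
qed

text \<open>The square-zero elements produced by \<open>mult_cabs_swap\<close> lie in \<open>B\<close>.\<close>

lemma abs_wave_swap_reduced:
  assumes u: "unitary u" "u \<in> idealizer B" and y: "y \<in> B"
  shows "abs_wave_swap u y"
  unfolding abs_wave_swap_def Let_def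
proof
  fix t
  let ?v = "scaleC (cis t) u" let ?b = "wave ?v"
  have v: "unitary ?v" by (rule unitary_scaleC_cis[OF u(1)])
  have "?v \<in> idealizer B" "star ?v \<in> idealizer B" using idealizer_mem(3) idealizer_star u(2) by blast+
  then have b: "?b \<in> idealizer B"
    unfolding wave_def
    by - (rule idealizer_mem(3), (assumption | rule idealizer_mem(4,5) idealizer_diff)+)
  have c: "cabs ?b \<in> idealizer B"
    unfolding cabs_def
    by (intro idealizer_sqrt1m norm_one_minus_square_le wave_selfadjoint norm_wave_le v
        idealizer_diff idealizer_mem(2,5) b)
  have mem: "v * y * w \<in> B" if "v \<in> idealizer B" "w \<in> idealizer B" for v w
    using that y unfolding idealizer_def by blast
  show "?b * y * cabs ?b = cabs ?b * y * ?b"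
  proof (rule mult_cabs_swap[OF wave_selfadjoint norm_wave_le[OF v]])
    fix z assume z: "z = (cabs ?b + ?b) * y * (cabs ?b - ?b) \<or> z = (cabs ?b - ?b) * y * (cabs ?b + ?b)"
      and "z * z = 0"
    have "z \<in> B" using z by (auto intro!: mem idealizer_mem(4) idealizer_diff b c)
    then show "z = 0" using reduced \<open>z * z = 0\<close> by blast
  qed
qed

text \<open>A small multiple \<open>h\<close> of \<open>a\<close> is the imaginary part of the unitary \<open>u = \<surd>(1 - h\<^sup>2) + \<i> h\<close>, which is
  near \<open>1\<close> and hence commutes with \<open>y\<close>.\<close>

lemma selfadjoint_commute_reduced:
  assumes a: "a \<in> B" "star a = a" and y: "y \<in> B"
  shows "a * y = y * a"
proof -
  obtain \<delta> where \<delta>: "\<delta> > 0" and near: "\<And>(u :: 'v) y. unitary u \<Longrightarrow> abs_wave_swap u y \<Longrightarrow>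
      norm (u - 1) < \<delta> \<Longrightarrow> u * y = y * u"
    using swap_imp_commute_near_one[where 'v = 'v] by blast
  define r where "r = min 1 (\<delta> / 3) / (norm a + 1)"
  have pos: "norm a + 1 > 0" using norm_ge_zero[of a] by linarith
  then have r: "r > 0" unfolding r_def using \<delta> by simp
  define h where "h = r *\<^sub>R a"
  have "norm h \<le> r * (norm a + 1)" using r by (simp add: h_def mult_left_mono)
  also have "\<dots> = min 1 (\<delta> / 3)" using pos by (simp add: r_def)
  finally have h1: "norm h \<le> 1" and h\<delta>: "norm h \<le> \<delta> / 3" by simp_all
  have hB: "h \<in> B" using scaleC[OF a(1), of "of_real r"] by (simp add: h_def scaleC_of_real)
  have hs: "star h = h" using a(2) by (simp add: h_def)
  have hh: "norm (h * h) \<le> norm h"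
    using norm_mult_ineq[of h h] mult_left_mono[OF h1 norm_ge_zero[of h]] by simp
  define u where "u = sqrt1m (h * h) + scaleC \<i> h"
  have u: "unitary u" and ss: "star (sqrt1m (h * h)) = sqrt1m (h * h)"
    unfolding u_def by (rule unitary_sqrt1m_plus_ii[OF hs h1])+
  have "u \<in> idealizer B"
    unfolding u_def using hh h1 mult[OF hB hB] hB
    by (intro idealizer_mem(3,4) idealizer_sqrt1m idealizer_mem(1)) auto
  moreover have "norm (u - 1) < \<delta>"
  proof -
    have "norm (u - 1) \<le> norm (sqrt1m (h * h) - 1) + norm (scaleC \<i> h)"
      using norm_triangle_ineq[of "sqrt1m (h * h) - 1" "scaleC \<i> h"] by (simp add: u_def algebra_simps)
    also have "\<dots> \<le> norm h + norm h"
      using norm_sqrt1m_minus_one_le[of "h * h"] hh h1 by (simp add: norm_scaleC)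
    finally show ?thesis using h\<delta> \<delta> by linarith
  qed
  ultimately have uy: "u * y = y * u" using near[OF u abs_wave_swap_reduced[OF u _ y]] by blast
  have "star u * y = star u * (y * u) * star u" using u by (simp add: unitary_def mult.assoc)
  also have "\<dots> = y * star u" using u by (simp add: uy[symmetric] unitary_def mult.assoc[symmetric])
  finally have "(u - star u) * y = y * (u - star u)"
    using uy by (simp add: left_diff_distrib right_diff_distrib)
  moreover have "u - star u = scaleC (2 * \<i>) h"
    using scaleC_add_left[of \<i> \<i> h] by (simp add: u_def star_add star_scaleC ss hs scaleC_minus_left)
  ultimately have "scaleC (2 * \<i> * of_real r) (a * y) = scaleC (2 * \<i> * of_real r) (y * a)"
    by (simp add: h_def scaleC_of_real[symmetric] scaleC_scaleC scaleC_mult_left scaleC_mult_right)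
  moreover have "2 * \<i> * of_real r \<noteq> 0" using r by simp
  ultimately show ?thesis using scaleC_cancel by blast
qed

lemma commute_reduced:
  assumes x: "x \<in> B" and y: "y \<in> B"
  shows "x * y = y * x"
proof -
  let ?h = "x + star x" let ?k = "scaleC \<i> (x + scaleC (-1) (star x))"
  have "?h \<in> B" "?k \<in> B" using x by (intro add scaleC star; simp)+
  moreover have "star ?h = ?h" "star ?k = ?k"
    by (simp_all add: star_add star_diff star_scaleC star_star scaleC_minus_left scaleC_diff_right
        add.commute)
  ultimately have "?h * y = y * ?h" "?k * y = y * ?k" using selfadjoint_commute_reduced y by blast+
  then have "(?h + scaleC (- \<i>) ?k) * y = y * (?h + scaleC (- \<i>) ?k)"
    by (simp only: distrib_left distrib_right scaleC_mult_left scaleC_mult_right)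
  also have "?h + scaleC (- \<i>) ?k = 2 *\<^sub>R x"
    by (simp add: scaleC_scaleC scaleC_minus_left scaleR_2)
  finally have "2 *\<^sub>R (x * y) = 2 *\<^sub>R (y * x)" by (simp only: mult_scaleR_left mult_scaleR_right)
  then show ?thesis by simp
qed

end

section \<open>The unitization\<close>

datatype 'a unitization = Unitization (algebra_part: 'a) (scalar_part: complex)

text \<open>Left multiplication by a formal sum \<open>a + \<lambda>1\<close> on the algebra itself.\<close>

definition unitization_act :: "'a::cstar_algebra unitization \<Rightarrow> 'a \<Rightarrow> 'a" where
  "unitization_act v y = algebra_part v * y + scaleC (scalar_part v) y"

lemma bounded_linear_unitization_act: "bounded_linear (unitization_act v)"
  unfolding unitization_act_def
  by (intro bounded_linear_add bounded_linear_mult_right bounded_linear_scaleC)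

text \<open>The norm is the operator norm of left multiplication, as it has to be when the algebra has no
  unit. If it has one, \<open>e\<close> say, then \<open>1 - e\<close> acts as zero; including the modulus of the scalar part
  makes this a C*-norm in either case.\<close>

instantiation unitization :: (cstar_algebra) real_normed_algebra_1
begin

definition "0 = Unitization 0 0"
definition "1 = Unitization 0 1"
definition "v + w = Unitization (algebra_part v + algebra_part w) (scalar_part v + scalar_part w)"
definition "v - w = Unitization (algebra_part v - algebra_part w) (scalar_part v - scalar_part w)"
definition "- v = Unitization (- algebra_part v) (- scalar_part v)"
definition "v * w = Unitization
  (algebra_part v * algebra_part w + scaleC (scalar_part v) (algebra_part w) +
    scaleC (scalar_part w) (algebra_part v)) (scalar_part v * scalar_part w)"
definition "r *\<^sub>R v = Unitization (r *\<^sub>R algebra_part v) (r *\<^sub>R scalar_part v)"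
definition "norm v = max (cmod (scalar_part v)) (onorm (unitization_act v))"
definition "dist v w = norm (v - w :: 'a unitization)"
definition "sgn v = inverse (norm v) *\<^sub>R (v :: 'a unitization)"
definition "uniformity = (INF e\<in>{0<..}. principal {(v, w :: 'a unitization). dist v w < e})"
definition "open U \<longleftrightarrow> (\<forall>v\<in>U. \<forall>\<^sub>F (v', w) in uniformity. v' = v \<longrightarrow> (w :: 'a unitization) \<in> U)"

lemmas unitization_defs = zero_unitization_def one_unitization_def plus_unitization_def
  minus_unitization_def uminus_unitization_def times_unitization_def scaleR_unitization_def

lemma unitization_parts [simp]:
  "algebra_part 0 = (0 :: 'a)" "scalar_part (0 :: 'a unitization) = 0"
  "algebra_part 1 = (0 :: 'a)" "scalar_part (1 :: 'a unitization) = 1"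
  "algebra_part (v + w) = algebra_part v + (algebra_part w :: 'a)"
  "scalar_part (v + w) = scalar_part v + scalar_part w"
  "algebra_part (v - w) = algebra_part v - algebra_part w"
  "scalar_part (v - w) = scalar_part v - scalar_part w"
  "algebra_part (- v) = - algebra_part v" "scalar_part (- v) = - scalar_part v"
  "algebra_part (v * w) = algebra_part v * algebra_part w + scaleC (scalar_part v) (algebra_part w) +
    scaleC (scalar_part w) (algebra_part v)"
  "scalar_part (v * w) = scalar_part v * scalar_part w"
  "algebra_part (r *\<^sub>R v) = r *\<^sub>R algebra_part v" "scalar_part (r *\<^sub>R v) = r *\<^sub>R scalar_part v"
  by (simp_all add: unitization_defs)

lemma unitization_eq_iff:
  "v = w \<longleftrightarrow> algebra_part v = algebra_part w \<and> scalar_part v = scalar_part w"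
  by (cases v; cases w) simp

lemma unitization_act_simps:
  fixes v w :: "'a unitization"
  shows "unitization_act (v + w) = (\<lambda>y. unitization_act v y + unitization_act w y)"
    and "unitization_act (v * w) = unitization_act v \<circ> unitization_act w"
    and "unitization_act (r *\<^sub>R v) = (\<lambda>y. r *\<^sub>R unitization_act v y)"
    and "unitization_act (1 :: 'a unitization) = (\<lambda>y. y)"
    and "unitization_act (0 :: 'a unitization) = (\<lambda>y. 0)"
  by (simp_all add: fun_eq_iff unitization_act_def distrib_left distrib_right scaleC_add_left
      scaleC_add_right scaleC_mult_left scaleC_mult_right scaleC_scaleC mult.assoc scaleR_add_right
      scaleC_scaleR_left)

lemma onorm_unitization_act_nonneg: "0 \<le> onorm (unitization_act (v :: 'a unitization))"
  by (rule onorm_pos_le[OF bounded_linear_unitization_act])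

text \<open>Left multiplication is isometric on the algebra, as \<open>\<parallel>a a\<^sup>*\<parallel> = \<parallel>a\<parallel>\<^sup>2\<close>; so the norm is
  equivalent to the sum of the norms of the two parts.\<close>

lemma norm_algebra_part_le:
  "norm (algebra_part v :: 'a) \<le> onorm (unitization_act v) + cmod (scalar_part v)"
proof (cases "algebra_part v = 0")
  case True
  then show ?thesis using onorm_unitization_act_nonneg[of v] by simp
next
  case False
  let ?a = "algebra_part v"
  have "norm ?a * norm ?a = norm (?a * star ?a)"
    using cstar_identity[of "star ?a"] by (simp add: star_star power2_eq_square)
  also have "?a * star ?a = unitization_act v (star ?a) - scaleC (scalar_part v) (star ?a)"
    by (simp add: unitization_act_def)
  also have "norm \<dots> \<le> onorm (unitization_act v) * norm ?a + cmod (scalar_part v) * norm ?a"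
    using norm_triangle_ineq4[of "unitization_act v (star ?a)" "scaleC (scalar_part v) (star ?a)"]
      onorm[OF bounded_linear_unitization_act, of v "star ?a"] by (simp add: norm_scaleC)
  finally have "norm ?a * norm ?a \<le> (onorm (unitization_act v) + cmod (scalar_part v)) * norm ?a"
    by (simp add: distrib_right)
  then show ?thesis using False by simp
qed

instance
proof
  fix u v w :: "'a unitization" and r s :: real
  show "u + v + w = u + (v + w)" "u + v = v + u" "0 + v = v" "- v + v = 0" "u - v = u + - v"
    "r *\<^sub>R (v + w) = r *\<^sub>R v + r *\<^sub>R w" "(r + s) *\<^sub>R v = r *\<^sub>R v + s *\<^sub>R v"
    "r *\<^sub>R s *\<^sub>R v = (r * s) *\<^sub>R v" "1 *\<^sub>R v = v"
    by (simp_all add: unitization_eq_iff scaleR_add_right scaleR_add_left add.assoc add.commute)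
  show "u * v * w = u * (v * w)"
    by (simp add: unitization_eq_iff algebra_simps scaleC_add_right scaleC_mult_left
        scaleC_mult_right scaleC_scaleC)
  show "(u + v) * w = u * w + v * w" "u * (v + w) = u * v + u * w"
    by (simp_all add: unitization_eq_iff algebra_simps scaleC_add_right scaleC_add_left)
  show "r *\<^sub>R v * w = r *\<^sub>R (v * w)" "v * r *\<^sub>R w = r *\<^sub>R (v * w)"
    by (simp_all add: unitization_eq_iff scaleR_add_right scaleC_scaleR scaleC_scaleR_left)
  show "1 * v = v" "v * 1 = v" "(0 :: 'a unitization) \<noteq> 1"
    by (simp_all add: unitization_eq_iff)
  show "dist v w = norm (v - w)" "sgn v = inverse (norm v) *\<^sub>R v"
    "uniformity = (INF e\<in>{0<..}. principal {(v, w :: 'a unitization). dist v w < e})"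
    "open U \<longleftrightarrow> (\<forall>v\<in>U. \<forall>\<^sub>F (v', w) in uniformity. v' = v \<longrightarrow> w \<in> U)" for U :: "'a unitization set"
    by (simp_all add: dist_unitization_def sgn_unitization_def uniformity_unitization_def
        open_unitization_def)
  show "norm v = 0 \<longleftrightarrow> v = 0"
  proof
    assume "norm v = 0"
    then have "cmod (scalar_part v) = 0" "onorm (unitization_act v) = 0"
      using onorm_unitization_act_nonneg[of v] norm_ge_zero[of "scalar_part v"]
      unfolding norm_unitization_def by linarith+
    then show "v = 0" using norm_algebra_part_le[of v] by (simp add: unitization_eq_iff)
  qed (simp add: norm_unitization_def unitization_act_simps onorm_zero)
  show "norm (v + w) \<le> norm v + norm w"
    using onorm_triangle[OF bounded_linear_unitization_act[of v] bounded_linear_unitization_act[of w]]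
      norm_triangle_ineq[of "scalar_part v" "scalar_part w"]
    unfolding norm_unitization_def unitization_act_simps unitization_parts by linarith
  show "norm (r *\<^sub>R v) = \<bar>r\<bar> * norm v"
    unfolding norm_unitization_def unitization_act_simps unitization_parts
      onorm_scaleR[OF bounded_linear_unitization_act] norm_scaleR
    by (simp add: max_mult_distrib_left)
  show "norm (v * w) \<le> norm v * norm w"
    unfolding norm_unitization_def unitization_act_simps unitization_parts norm_mult
    by (intro max.boundedI order_trans[OF onorm_compose[OF bounded_linear_unitization_act
          bounded_linear_unitization_act]] mult_mono) (simp_all add: onorm_unitization_act_nonneg le_max_iff_disj)
  show "norm (1 :: 'a unitization) = 1"
    unfolding norm_unitization_def unitization_act_simps unitization_parts
    using onorm_id_le[where 'a = 'a] by simp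
qed

end

lemma bounded_linear_algebra_part: "bounded_linear (algebra_part :: 'a::cstar_algebra unitization \<Rightarrow> 'a)"
proof (rule bounded_linear_intro[where K = 2])
  fix v :: "'a unitization"
  show "norm (algebra_part v) \<le> norm v * 2"
    using norm_algebra_part_le[of v] unfolding norm_unitization_def by linarith
qed simp_all

lemma bounded_linear_scalar_part:
  "bounded_linear (scalar_part :: 'a::cstar_algebra unitization \<Rightarrow> complex)"
  by (rule bounded_linear_intro[where K = 1]) (simp_all add: norm_unitization_def)

lemma norm_Unitization_le: "norm (Unitization a c) \<le> norm (a :: 'a::cstar_algebra) + cmod c"
proof -
  have "onorm (unitization_act (Unitization a c)) \<le> norm a + cmod c"
  proof (rule onorm_bound)
    fix y
    show "norm (unitization_act (Unitization a c) y) \<le> (norm a + cmod c) * norm y"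
      using norm_triangle_ineq[of "a * y" "scaleC c y"] norm_mult_ineq[of a y]
      by (simp add: unitization_act_def norm_scaleC distrib_right)
  qed simp
  then show ?thesis by (simp add: norm_unitization_def)
qed

instance unitization :: (cstar_algebra) banach
proof
  fix X :: "nat \<Rightarrow> 'a unitization"
  assume X: "Cauchy X"
  obtain a where a: "(\<lambda>n. algebra_part (X n)) \<longlonglongrightarrow> a"
    using bounded_linear.Cauchy[OF bounded_linear_algebra_part X] Cauchy_convergent convergentD by blast
  obtain c where c: "(\<lambda>n. scalar_part (X n)) \<longlonglongrightarrow> c"
    using bounded_linear.Cauchy[OF bounded_linear_scalar_part X] Cauchy_convergent convergentD by blast
  have "(\<lambda>n. X n - Unitization a c) \<longlonglongrightarrow> 0"
  proof (rule Lim_null_comparison)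
    show "\<forall>\<^sub>F n in sequentially. norm (X n - Unitization a c) \<le>
        norm (algebra_part (X n) - a) + norm (scalar_part (X n) - c)"
      by (intro always_eventually allI)
        (simp add: minus_unitization_def norm_Unitization_le)
    show "(\<lambda>n. norm (algebra_part (X n) - a) + norm (scalar_part (X n) - c)) \<longlonglongrightarrow> 0"
      using tendsto_add[OF tendsto_norm[OF LIM_zero[OF a]] tendsto_norm[OF LIM_zero[OF c]]] by simp
  qed
  then show "convergent X" using LIM_zero_iff convergentI by blast
qed

instantiation unitization :: (cstar_algebra) unital_cstar_algebra
begin

definition "scaleC c v = Unitization (scaleC c (algebra_part v)) (c * scalar_part v)"
definition "star v = Unitization (star (algebra_part v)) (cnj (scalar_part v))"

lemma unitization_cstar_parts [simp]:
  "algebra_part (scaleC c v) = scaleC c (algebra_part v :: 'a)" "scalar_part (scaleC c v) = c * scalar_part v"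
  "algebra_part (star v) = star (algebra_part v)" "scalar_part (star v) = cnj (scalar_part v)"
  by (simp_all add: scaleC_unitization_def star_unitization_def)

lemma star_unitization_act:
  "star (unitization_act v y) * z = star y * unitization_act (star v) (z :: 'a)"
  by (simp add: unitization_act_def star_add star_mult star_scaleC distrib_left distrib_right
      mult.assoc scaleC_mult_left scaleC_mult_right)

text \<open>The C*-identity of the algebra, applied to the values \<open>unitization_act v y\<close>.\<close>

lemma onorm_unitization_act_square_le:
  "(onorm (unitization_act v))\<^sup>2 \<le> onorm (unitization_act (star v * v :: 'a unitization))"
proof -
  let ?N = "onorm (unitization_act (star v * v))"
  have N: "0 \<le> ?N" by (rule onorm_unitization_act_nonneg)
  have "onorm (unitization_act v) \<le> sqrt ?N"
  proof (rule onorm_bound)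
    fix y
    have "(norm (unitization_act v y))\<^sup>2 = norm (star y * unitization_act (star v * v) y)"
      unfolding cstar_identity[symmetric] star_unitization_act by (simp add: unitization_act_simps)
    also have "\<dots> \<le> norm y * (?N * norm y)"
      using norm_mult_ineq[of "star y" "unitization_act (star v * v) y"]
        mult_left_mono[OF onorm[OF bounded_linear_unitization_act[of "star v * v"], of y] norm_ge_zero[of y]]
      by simp
    also have "\<dots> = (sqrt ?N * norm y)\<^sup>2" using N by (simp add: power2_eq_square mult_ac)
    finally show "norm (unitization_act v y) \<le> sqrt ?N * norm y"
      by (rule power2_le_imp_le) (simp add: N)
  qed (simp add: N)
  then have "(onorm (unitization_act v))\<^sup>2 \<le> (sqrt ?N)\<^sup>2"
    by (rule power_mono) (rule onorm_unitization_act_nonneg)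
  then show ?thesis using N by simp
qed

lemma onorm_unitization_act_star_mult_le:
  "onorm (unitization_act (star v * v :: 'a unitization)) \<le>
    onorm (unitization_act (star v)) * onorm (unitization_act v)"
  unfolding unitization_act_simps
  by (rule onorm_compose[OF bounded_linear_unitization_act bounded_linear_unitization_act])

instance
proof
  fix v w :: "'a unitization" and c d :: complex
  show "scaleC c (v + w) = scaleC c v + scaleC c w" "scaleC (c + d) v = scaleC c v + scaleC d v"
    "scaleC c (scaleC d v) = scaleC (c * d) v" "star (v + w) = star v + star w"
    "star (scaleC c v) = scaleC (cnj c) (star v)"
    by (simp_all add: unitization_eq_iff scaleC_add_right scaleC_add_left scaleC_scaleC star_add
        star_scaleC distrib_left distrib_right)
  show ss: "star (star v) = v" for v :: "'a unitization"
    by (simp add: unitization_eq_iff star_star)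
  show "scaleC (complex_of_real r) v = r *\<^sub>R v" for r
    by (simp add: unitization_eq_iff scaleC_of_real scaleR_conv_of_real[where 'a = complex])
  show "scaleC c v * w = scaleC c (v * w)" "v * scaleC c w = scaleC c (v * w)"
    by (simp_all add: unitization_eq_iff scaleC_add_right scaleC_mult_left scaleC_mult_right
        scaleC_scaleC mult_ac)
  show "star (v * w) = star w * star v"
    by (simp add: unitization_eq_iff star_add star_mult star_scaleC add_ac)
  have "unitization_act (scaleC c v) = (\<lambda>y. scaleC c (unitization_act v y))"
    by (simp add: fun_eq_iff unitization_act_def scaleC_add_right scaleC_mult_left scaleC_scaleC)
  then have "onorm (unitization_act (scaleC c v)) = onorm (\<lambda>y. cmod c *\<^sub>R unitization_act v y)"
    unfolding onorm_def by (simp add: norm_scaleC)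
  then show "norm (scaleC c v) = cmod c * norm v"
    unfolding norm_unitization_def onorm_scaleR[OF bounded_linear_unitization_act]
    by (simp add: norm_mult max_mult_distrib_left)
  have le: "onorm (unitization_act v) \<le> onorm (unitization_act (star v))" for v :: "'a unitization"
  proof (cases "onorm (unitization_act v) = 0")
    case False
    then have "0 < onorm (unitization_act v)" using onorm_unitization_act_nonneg[of v] by simp
    moreover have "onorm (unitization_act v) * onorm (unitization_act v) \<le>
        onorm (unitization_act (star v)) * onorm (unitization_act v)"
      using onorm_unitization_act_square_le[of v] onorm_unitization_act_star_mult_le[of v]
      by (simp add: power2_eq_square)
    ultimately show ?thesis by simp
  qed (simp add: onorm_unitization_act_nonneg)
  then have "onorm (unitization_act (star v)) = onorm (unitization_act v)"
    using le[of "star v"] ss[of v] by (simp add: antisym)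
  then have act: "onorm (unitization_act (star v * v)) = (onorm (unitization_act v))\<^sup>2"
    using onorm_unitization_act_square_le[of v] onorm_unitization_act_star_mult_le[of v]
    by (simp add: power2_eq_square)
  have scal: "cmod (scalar_part (star v * v)) = (cmod (scalar_part v))\<^sup>2"
    by (simp add: norm_mult power2_eq_square)
  have "max (a\<^sup>2) (b\<^sup>2) = (max a b)\<^sup>2" if "0 \<le> a" "0 \<le> b" for a b :: real
    using that by (simp add: max_def power_mono_iff)
  then show "norm (star v * v) = (norm v)\<^sup>2"
    unfolding norm_unitization_def act scal by (simp add: onorm_unitization_act_nonneg)
qed

end

section \<open>Boolean lattices of annihilators\<close>

text \<open>The copy of \<open>B\<close> in the unitization is again a closed self-adjoint subalgebra.\<close>

lemma commute_if_reduced: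
  fixes B :: "'a::cstar_algebra set"
  assumes B: "B \<in> annihilators" and reduced: "\<And>x. x \<in> B \<Longrightarrow> x * x = 0 \<Longrightarrow> x = 0"
    and x: "x \<in> B" and y: "y \<in> B"
  shows "x * y = y * x"
proof -
  let ?U = "{v. algebra_part v \<in> B \<and> scalar_part v = 0}"
  have "closed B" using closed_annihilator annihilators_bipolar[OF B] by metis
  then have "closed (algebra_part -` B \<inter> scalar_part -` {0} :: 'a unitization set)"
    by (intro closed_Int closed_vimage bounded_linear.continuous_on[OF bounded_linear_algebra_part]
        bounded_linear.continuous_on[OF bounded_linear_scalar_part] continuous_on_id closed_singleton)
  then have "closed ?U" by (simp add: vimage_def Int_def)
  have "Unitization x 0 * Unitization y 0 = Unitization y 0 * Unitization x 0"
  proof (rule commute_reduced[where B = ?U])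
    show "v + w \<in> ?U" if "v \<in> ?U" "w \<in> ?U" for v w
      using that annihilators_add[OF B] by simp
    show "v * w \<in> ?U" if "v \<in> ?U" "w \<in> ?U" for v w
      using that annihilators_mult[OF B] by simp
    show "scaleC c v \<in> ?U" if "v \<in> ?U" for c v
      using that annihilators_scaleC[OF B] by simp
    show "star v \<in> ?U" if "v \<in> ?U" for v
      using that annihilators_star[OF B] by simp
    show "v = 0" if "v \<in> ?U" "v * v = 0" for v
      using that reduced[of "algebra_part v"] by (simp add: unitization_eq_iff)
  qed (use \<open>closed ?U\<close> x y in simp_all)
  then show ?thesis by (simp add: unitization_eq_iff)
qed

theorem theorem3p49:
  fixes B :: "'a::cstar_algebra set"
  assumes "B \<in> annihilators"
  shows "(\<forall>x\<in>B. \<forall>y\<in>B. x * y = y * x) \<longleftrightarrow> boolean_lattice (annihilators_below B)"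
proof
  assume "\<forall>x\<in>B. \<forall>y\<in>B. x * y = y * x"
  then show "boolean_lattice (annihilators_below B)"
    using boolean_lattice_of_commutative[OF assms] by blast
next
  assume "boolean_lattice (annihilators_below B)"
  then show "\<forall>x\<in>B. \<forall>y\<in>B. x * y = y * x"
    using commute_if_reduced[OF assms square_zero_of_boolean_lattice[OF assms]] by blast
qed

end
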